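(* Let the iterates be generated by AdGT with the local-gradient stepsize update $$\alpha_i^{k+1}=\min\Big\{\tfrac{1}{2\gamma L_{f_i}^k},\ \sqrt{1+\theta_i^k}\,\alpha_i^k\Big\}\qquad(i\in\mathcal V,\ k\ge 0),$$ as described in the context. Suppose that $\mathcal G$ is undirected and connected, that each $f_i$ is $L_i$-smooth and $\mu_i$-strongly convex with $\mu_i>0$, that $L_{f_i}^0$ is well defined for every agent $i$ (i.e. $\bm x_i^1\neq \bm x_i^0$), and that $\alpha_i^0\ge \frac{1}{2\gamma L_i}$ for every $i$. Let $L=\max_i L_i$, $\mu=\min_i\mu_i$, and assume $\lambda>0$. Let $\delta_1,\delta_2$ satisfy $$0<\delta_1<\frac{1-\lambda}{L\,|||W-I|||},\qquad \delta_2>\Big(\frac{L}{\sqrt n}\delta_1+\frac{1}{\sqrt n}\Big)\frac{L}{\mu^2},$$ and let $$\bar\alpha=\min\left\{\frac{(1-\lambda)\delta_1}{\lambda\,(L\delta_1+1+\sqrt n\,L\delta_2)},\ \frac{(1-\lambda)-L\,|||W-I|||\,\delta_1}{L\,(L\delta_1+1+\sqrt n\,L\delta_2)}\right\}>0 .$$ Suppose that $$\gamma>\max\Big\{\frac{L}{\mu},\ \frac{1}{2\mu\bar\alpha}\Big\}.$$ Then the sequence $\{\mathbf x^k\}$ converges linearly to $\mathbf x^*=\mathbf 1\bm x^*$ (the matrix all of whose rows equal the minimizer $\bm x^*$) after the initialization step, with a rate arbitrarily close to $\rho(\Upsilon)$; that is, for every $\zeta\in(0,1-\rho(\Upsilon))$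 there is a constant $C\ge 0$ such that $$\|\mathbf x^k-\mathbf 1\bm x^*\|\le C\,(\rho(\Upsilon)+\zeta)^{k-1}\qquad\text{for all }k\ge 1 .$$
   Context: Problem. Let $\mathcal G=(\mathcal V,\mathcal E)$, $\mathcal V=\{1,\dots,n\}$, be an undirected connected graph, and let $\mathcal N_i=\{j:(j,i)\in\mathcal E\}\cup\{i\}$. $W=[w_{ij}]\in\mathbb R^{n\times n}$ is a symmetric doubly stochastic matrix with $w_{ij}>0$ if $j\in\mathcal N_i$ and $w_{ij}=0$ otherwise. Each agent $i$ has a function $f_i:\mathbb R^p\to\mathbb R$. The function $f_i$ is $L_i$-smooth if it is differentiable with $\|\nabla f_i(\bm x)-\nabla f_i(\bm x')\|\le L_i\|\bm x-\bm x'\|$ for all $\bm x,\bm x'$; it is $\mu_i$-strongly convex if $f_i(\bm y)\ge f_i(\bm x)+\nabla f_i(\bm x)^\top(\bm y-\bm x)+\frac{\mu_i}{2}\|\bm y-\bm x\|^2$ for all $\bm x,\bm y$. $\bm x^*$ denotes the unique minimizer of $\frac1n\sum_{i=1}^n f_i$. Algorithm AdGT. Given $\gamma>0$ (a common safety factor), $\bm x_i^0\in\mathbb R^p$, $\bm y_i^0=\nabla f_i(\bm x_i^0)$, $\alpha_i^0>0$, $\theta_i^0=0$, for $k=0,1,\dots$ every agent $i$ computes $$\bm x_i^{k+1}=\sum_{j\in\mathcal N_i}w_{ij}(\bm x_j^k-\alpha_j^k\bm y_j^k),\qquad \bm y_i^{k+1}=\sum_{j\in\mathcal N_i}w_{ij}\bm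 y_j^k+\nabla f_i(\bm x_i^{k+1})-\nabla f_i(\bm x_i^k),$$ then $\alpha_i^{k+1}$ by the stated stepsize update, and $\theta_i^{k+1}=\alpha_i^{k+1}/\alpha_i^k$. Here $$L_{f_i}^k=\frac{\|\nabla f_i(\bm x_i^{k+1})-\nabla f_i(\bm x_i^k)\|}{\|\bm x_i^{k+1}-\bm x_i^k\|}.$$ Convention: if $\bm x_i^{k+1}=\bm x_i^k$ for some $k\ge1$, set $\alpha_i^{k+1}=\alpha_i^k$. Notation. $\|\cdot\|$ is the Euclidean norm for vectors and the Frobenius norm for matrices; $|||\cdot|||$ is the spectral norm; $\rho(\cdot)$ is the spectral radius; $\mathbf 1\in\mathbb R^n$ is the all-ones column vector. $\mathbf x^k\in\mathbb R^{n\times p}$ has rows $(\bm x_i^k)^\top$. With $\lambda_1\ge\dots\ge\lambda_n$ the eigenvalues of $W$, $\lambda=\max\{|\lambda_2|,|\lambda_n|\}=|||W-\frac1n\mathbf 1\mathbf 1^\top|||<1$. Let $\alpha_{\max}=\sup_{i\in\mathcal V,\,k\ge1}\alpha_i^k$ and $$\Upsilon=\begin{bmatrix}\lambda+\lambda\alpha_{\max}L & \lambda\alpha_{\max} & \sqrt n\,\lambda\alpha_{\max}L\\ L(|||W-I|||+L\alpha_{\max}) & \lambda+L\alpha_{\max} & \sqrt n\,L^2\alpha_{\max}\\ L\frac{\alpha_{\max}}{\sqrt n} & \frac{\alpha_{\max}}{\sqrt n} & 1-\frac{\mu}{2\gamma L}\end{bmatrix}.$$ *)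

theory Defs
  imports
    "HOL-Analysis.Analysis"
    "Jordan_Normal_Form.Spectral_Radius"
begin

no_notation Matrix.vec_index (infixl \<open>$\<close> 100)
unbundle no fps_syntax

text \<open>
  Agents are the elements of a finite type \<open>'n\<close>, so that \<open>n = CARD('n)\<close>; the decision space
  is \<open>real ^ 'p\<close>. A stacked iterate has type \<open>real ^ 'p ^ 'n\<close>: its \<open>i\<close>-th row is the vector of
  agent \<open>i\<close>, and its library norm is the Frobenius norm.
\<close>

subsection \<open>Functions\<close>

text \<open>Only meaningful at points of differentiability, where the gradient is unique.\<close>

definition grad :: "('a::real_inner \<Rightarrow> real) \<Rightarrow> 'a \<Rightarrow> 'a" where
  "grad f x = (THE D. GDERIV f x :> D)"

definition smooth_with :: "real \<Rightarrow> ('a::euclidean_space \<Rightarrow> real) \<Rightarrow> bool" where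
  "smooth_with L f \<longleftrightarrow>
     (\<forall>x. f differentiable (at x)) \<and>
     (\<forall>x x'. norm (grad f x - grad f x') \<le> L * norm (x - x'))"

definition strongly_convex_with :: "real \<Rightarrow> ('a::euclidean_space \<Rightarrow> real) \<Rightarrow> bool" where
  "strongly_convex_with \<mu> f \<longleftrightarrow>
     (\<forall>x y. f y \<ge> f x + grad f x \<bullet> (y - x) + \<mu> / 2 * (norm (y - x))\<^sup>2)"

definition unique_minimizer :: "('a \<Rightarrow> real) \<Rightarrow> 'a" where
  "unique_minimizer F = (THE z. is_arg_min F (\<lambda>_. True) z)"

definition avg_fun :: "('n::finite \<Rightarrow> 'a \<Rightarrow> real) \<Rightarrow> 'a \<Rightarrow> real" where
  "avg_fun f z = 1 / real CARD('n) * (\<Sum>i\<in>UNIV. f i z)"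

subsection \<open>Graph and mixing matrix\<close>

definition undirected_connected :: "('n \<times> 'n) set \<Rightarrow> bool" where
  "undirected_connected E \<longleftrightarrow> sym E \<and> (\<forall>i j. (i, j) \<in> E\<^sup>*)"

definition nbhd :: "('n \<times> 'n) set \<Rightarrow> 'n \<Rightarrow> 'n set" where
  "nbhd E i = {j. (j, i) \<in> E} \<union> {i}"

definition mixing_matrix :: "('n::finite \<times> 'n) set \<Rightarrow> real ^ 'n ^ 'n \<Rightarrow> bool" where
  "mixing_matrix E W \<longleftrightarrow>
     Finite_Cartesian_Product.transpose W = W \<and>
     (\<forall>i. (\<Sum>j\<in>UNIV. W $ i $ j) = 1) \<and>
     (\<forall>j. (\<Sum>i\<in>UNIV. W $ i $ j) = 1) \<and>
     (\<forall>i j. if j \<in> nbhd E i then W $ i $ j > 0 else W $ i $ j = 0)"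

definition spectral_norm :: "real ^ 'm ^ 'n \<Rightarrow> real" where
  "spectral_norm A = onorm (\<lambda>v. A *v v)"

text \<open>
  The eigenvalues of a symmetric real matrix are all real, so the real roots of its
  characteristic polynomial \<open>det (t I - A)\<close>, taken with multiplicity, form the full list
  \<open>\<lambda>\<^sub>1 \<ge> \<dots> \<ge> \<lambda>\<^sub>n\<close>.
\<close>

definition charpoly :: "real ^ 'n ^ 'n \<Rightarrow> real poly" where
  "charpoly A =
     Determinants.det (\<chi> i j. (if i = j then [:0, 1:] else 0) - [:A $ i $ j:])"

definition eigenvalues_desc :: "real ^ 'n ^ 'n \<Rightarrow> real list" where
  "eigenvalues_desc A = rev (sorted_list_of_multiset (proots (charpoly A)))"

text \<open>
  \<open>max {\<bar>\<lambda>\<^sub>2\<bar>, \<bar>\<lambda>\<^sub>n\<bar>}\<close>. List positions start at \<open>0\<close>, so \<open>\<lambda>\<^sub>2\<close> is at position \<open>1\<close>.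
\<close>

definition mixing_rate :: "real ^ 'n ^ 'n \<Rightarrow> real" where
  "mixing_rate W = max \<bar>eigenvalues_desc W ! 1\<bar> \<bar>last (eigenvalues_desc W)\<bar>"

subsection \<open>The algorithm\<close>

definition local_lipschitz :: "('a::real_inner \<Rightarrow> real) \<Rightarrow> 'a \<Rightarrow> 'a \<Rightarrow> real" where
  "local_lipschitz f x x' = norm (grad f x' - grad f x) / norm (x' - x)"

text \<open>
  \<open>x\<close>, \<open>y\<close>, \<open>\<alpha>\<close>, \<open>\<theta>\<close> are the sequences produced by the algorithm from some initial
  points \<open>x 0\<close> and stepsizes \<open>\<alpha> 0\<close>. The exceptional branch of the stepsize update applies only
  from \<open>k = 1\<close> on; at \<open>k = 0\<close> the quotient is required to be well defined separately.
\<close>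

definition AdGT ::
  "('n::finite \<times> 'n) set \<Rightarrow> real ^ 'n ^ 'n \<Rightarrow> ('n \<Rightarrow> real ^ 'p::finite \<Rightarrow> real) \<Rightarrow> real \<Rightarrow>
   (nat \<Rightarrow> real ^ 'p ^ 'n) \<Rightarrow> (nat \<Rightarrow> real ^ 'p ^ 'n) \<Rightarrow>
   (nat \<Rightarrow> 'n \<Rightarrow> real) \<Rightarrow> (nat \<Rightarrow> 'n \<Rightarrow> real) \<Rightarrow> bool" where
  "AdGT E W f \<gamma> x y \<alpha> \<theta> \<longleftrightarrow>
     (\<forall>i. y 0 $ i = grad (f i) (x 0 $ i) \<and> \<alpha> 0 i > 0 \<and> \<theta> 0 i = 0) \<and>
     (\<forall>k i.
        x (Suc k) $ i = (\<Sum>j\<in>nbhd E i. (W $ i $ j) *\<^sub>R (x k $ j - \<alpha> k j *\<^sub>R (y k $ j))) \<and>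
        y (Suc k) $ i = (\<Sum>j\<in>nbhd E i. (W $ i $ j) *\<^sub>R (y k $ j))
                        + grad (f i) (x (Suc k) $ i) - grad (f i) (x k $ i) \<and>
        \<alpha> (Suc k) i =
          (if k \<ge> 1 \<and> x (Suc k) $ i = x k $ i then \<alpha> k i
           else min (1 / (2 * \<gamma> * local_lipschitz (f i) (x k $ i) (x (Suc k) $ i)))
                    (sqrt (1 + \<theta> k i) * \<alpha> k i)) \<and>
        \<theta> (Suc k) i = \<alpha> (Suc k) i / \<alpha> k i)"

text \<open>
  The matrix \<open>\<Upsilon>\<close>, for \<open>n\<close> agents with \<open>\<lambda> = lam\<close>, \<open>\<alpha>\<^sub>m\<^sub>a\<^sub>x = a\<close> and \<open>w\<close> the spectral norm of
  \<open>W - I\<close>. Its entries are real; they are embedded into the complex numbers because the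
  spectral radius ranges over complex eigenvalues.
\<close>

definition Upsilon ::
  "real \<Rightarrow> real \<Rightarrow> real \<Rightarrow> real \<Rightarrow> real \<Rightarrow> real \<Rightarrow> real \<Rightarrow> complex mat" where
  "Upsilon n lam w a L \<mu> \<gamma> = map_mat complex_of_real (mat_of_rows_list 3
     [[lam + lam * a * L, lam * a, sqrt n * lam * a * L],
      [L * (w + L * a), lam + L * a, sqrt n * L\<^sup>2 * a],
      [L * (a / sqrt n), a / sqrt n, 1 - \<mu> / (2 * \<gamma> * L)]])"

end

theory Submission
  imports Defs
begin

text \<open>
  Split every stacked iterate into its row mean and its deviation from that mean, and follow
  three scalar errors: the consensus error of \<open>x\<close>, the consensus error of the trackers \<open>y\<close>, and
  the distance of the mean of \<open>x\<close> to the minimizer \<open>x\<^sup>*\<close>. The claim is that the vector \<open>v\<^sub>k\<close> of these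
  errors satisfies \<open>v\<^sub>k\<^sub>+\<^sub>1 \<le> \<Upsilon> v\<^sub>k\<close> entrywise for \<open>k \<ge> 1\<close>. Since \<open>\<Upsilon>\<close> is nonnegative, this can be
  iterated, and \<open>\<Upsilon>\<^sup>k\<close> is at most a constant times \<open>(\<rho>(\<Upsilon>) + \<zeta>)\<^sup>k\<close>; this is the rate.

  Three facts give the recursion. First, \<open>W\<close> contracts deviations by \<open>\<lambda>\<close>: on the space of vectors
  with zero sum, a vector maximizing \<open>\<parallel>W v\<parallel>\<close> on the unit sphere yields an eigenvector whose
  eigenvalue has maximal modulus, and connectivity excludes the eigenvalue \<open>1\<close> there, so that
  this eigenvalue is one of \<open>\<lambda>\<^sub>2, \<dots>, \<lambda>\<^sub>n\<close> (\<open>norm_mult_le_mixing_rate\<close>). Second, mixing preserves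
  means, so the mean of \<open>y\<close> is always the mean of the local gradients; the mean of \<open>x\<close> therefore
  performs a gradient step on the average function, with the mean stepsize \<open>t\<close>, up to errors
  controlled by the two deviations. The exact step contracts by \<open>1 - t \<mu>\<close>
  (\<open>gradient_step_contraction\<close>). Third, the local curvature estimates lie between \<open>\<mu>\<^sub>i\<close> and \<open>L\<^sub>i\<close>, so
  the stepsizes stay between \<open>1 / (2 \<gamma> L\<^sub>i)\<close> and \<open>1 / (2 \<gamma> \<mu>\<^sub>i)\<close> (\<open>stepsize_bounds\<close>): the lower bound
  guarantees progress in every step, the upper bound, for \<open>k \<ge> 1\<close>, together with the lower
  bound on \<open>\<gamma>\<close> makes \<open>\<alpha>\<^sub>m\<^sub>a\<^sub>x\<close> smaller than \<open>\<alpha>bar\<close>.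

  That \<open>\<rho>(\<Upsilon>) < 1\<close> is a small-gain argument: the bounds on \<open>\<delta>\<^sub>1\<close>, \<open>\<delta>\<^sub>2\<close> and \<open>\<alpha>\<^sub>m\<^sub>a\<^sub>x\<close> ensure that
  the positive vector \<open>d = (\<delta>\<^sub>1, 1, \<delta>\<^sub>2)\<close> satisfies \<open>\<Upsilon> d < d\<close>, which bounds the modulus of every
  eigenvalue (\<open>spectral_radius_less_1_if_subinvariant\<close>).
\<close>

section \<open>Strongly convex functions with Lipschitz gradient\<close>

text \<open>
  The field \<open>g\<close> stands for the gradient. Axiomatizing it by these two inequalities makes the locale
  closed under averaging, so that every result below also applies to the average function with the
  mean of the local gradients.
\<close>

locale strongly_convex_smooth =
  fixes f :: "'a::real_inner \<Rightarrow> real" and g :: "'a \<Rightarrow> 'a" and L \<mu> :: real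
  assumes mu_pos: "\<mu> > 0"
    and above_tangent: "\<And>x y. f y \<ge> f x + g x \<bullet> (y - x) + \<mu> / 2 * (norm (y - x))\<^sup>2"
    and gradient_lipschitz: "\<And>x y. norm (g x - g y) \<le> L * norm (x - y)"
begin

lemma strongly_monotone: "\<mu> * (norm (x - y))\<^sup>2 \<le> (g x - g y) \<bullet> (x - y)"
  using above_tangent[of x y] above_tangent[of y x]
  by (simp add: inner_diff_left inner_diff_right norm_minus_commute[of y x])

lemma gradient_expansive: "\<mu> * norm (x - y) \<le> norm (g x - g y)"
proof (cases "x = y")
  case False
  have "\<mu> * norm (x - y) * norm (x - y) \<le> norm (g x - g y) * norm (x - y)"
    using strongly_monotone[of x y] norm_cauchy_schwarz[of "g x - g y" "x - y"]
    by (simp add: power2_eq_square)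
  then show ?thesis using False by simp
qed simp

text \<open>
  Convexity at \<open>y\<close> bounds the increment by \<open>g y \<bullet> (y - x)\<close>, and the Lipschitz condition exchanges
  \<open>g y\<close> for \<open>g x\<close>. Compared with integration along the segment this costs a factor of at most two in
  the quadratic term, which is harmless because the stepsizes considered later are below \<open>1 / (2 * L)\<close>.
\<close>

lemma quadratic_upper_bound:
  "f y \<le> f x + g x \<bullet> (y - x) + (L - \<mu> / 2) * (norm (y - x))\<^sup>2"
proof -
  have "f y - f x \<le> g y \<bullet> (y - x) - \<mu> / 2 * (norm (y - x))\<^sup>2"
    using above_tangent[of y x] by (simp add: inner_diff_right norm_minus_commute)
  also have "g y \<bullet> (y - x) = g x \<bullet> (y - x) + (g y - g x) \<bullet> (y - x)"
    by (simp add: inner_diff_left)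
  also have "(g y - g x) \<bullet> (y - x) \<le> L * (norm (y - x))\<^sup>2"
    using norm_cauchy_schwarz[of "g y - g x" "y - x"]
      mult_right_mono[OF gradient_lipschitz[of y x] norm_ge_zero[of "y - x"]]
    by (simp add: power2_eq_square)
  finally show ?thesis by (simp add: algebra_simps)
qed

text \<open>
  Two distinct points are required: in a space consisting of \<open>0\<close> alone \<open>L\<close> is unconstrained.
\<close>

lemma lipschitz_ge_convexity:
  fixes x y :: 'a
  assumes "x \<noteq> y"
  shows "\<mu> \<le> L"
  using order_trans[OF gradient_expansive gradient_lipschitz, of x y] assms by simp

lemma minimizer_unique:
  assumes "g z = 0"
  shows "unique_minimizer f = z"
proof -
  have bound: "f z + \<mu> / 2 * (norm (u - z))\<^sup>2 \<le> f u" for u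
    using above_tangent[of z u] assms by simp
  show ?thesis unfolding unique_minimizer_def
  proof (rule the_equality)
    show "is_arg_min f (\<lambda>_. True) z"
      unfolding is_arg_min_linorder
    proof (intro conjI allI impI TrueI)
      show "f z \<le> f u" for u
        using bound[of u] mu_pos by (smt (verit) mult_nonneg_nonneg zero_le_power2 divide_pos_pos)
    qed
  next
    fix u assume "is_arg_min f (\<lambda>_. True) u"
    then have "f u \<le> f z" by (simp add: is_arg_min_linorder)
    with bound[of u] have "\<mu> / 2 * (norm (u - z))\<^sup>2 \<le> 0" by linarith
    then show "u = z" using mu_pos by (simp add: mult_le_0_iff)
  qed
qed

lemma gradient_zero_at_minimum:
  assumes min: "\<And>u. f z \<le> f u"
  shows "g z = 0"
proof (rule ccontr)
  assume nz: "g z \<noteq> 0"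
  \<comment> \<open>the decrement along \<open>- g z\<close> is at least \<open>(t - M * t\<^sup>2) * (norm (g z))\<^sup>2\<close>, which is largest for
    \<open>t = 1 / (2 * M)\<close>\<close>
  define M where "M = max L \<mu>"
  have M: "M > 0" "L - \<mu> / 2 \<le> M" using mu_pos unfolding M_def by auto
  define t where "t = 1 / (2 * M)"
  have "f (z - t *\<^sub>R g z) \<le> f z + g z \<bullet> (- (t *\<^sub>R g z)) + (L - \<mu> / 2) * (norm (t *\<^sub>R g z))\<^sup>2"
    using quadratic_upper_bound[of "z - t *\<^sub>R g z" z] by simp
  also have "\<dots> \<le> f z - t * (norm (g z))\<^sup>2 + M * (t\<^sup>2 * (norm (g z))\<^sup>2)"
    using mult_right_mono[OF M(2), of "(norm (t *\<^sub>R g z))\<^sup>2"]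
    by (simp add: power_mult_distrib power2_norm_eq_inner)
  also have "\<dots> = f z - t / 2 * (norm (g z))\<^sup>2"
    using M unfolding t_def by (simp add: field_simps power2_eq_square)
  also have "\<dots> < f z" using nz M by (simp add: t_def)
  finally show False using min by (meson not_less)
qed

text \<open>
  Subtracting the quadratic \<open>\<mu> / 2 * \<parallel>z\<parallel>\<^sup>2\<close> leaves a convex function \<open>h\<close> with gradient \<open>r\<close> and a
  quadratic upper bound. Minimizing that upper bound around \<open>b\<close> improves the tangent inequality of
  \<open>h\<close> at \<open>a\<close> by a multiple of \<open>\<parallel>r b - r a\<parallel>\<^sup>2\<close>; adding the improved inequalities for both orders of
  the two points gives the cocoercivity of \<open>r\<close>, that is the Baillon-Haddad inequality.
\<close>

lemma cocoercive_shifted: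
  fixes x y :: 'a
  assumes "L > 0"
  defines "u \<equiv> (g x - g y) - \<mu> *\<^sub>R (x - y)"
  shows "(norm u)\<^sup>2 \<le> 2 * L * (u \<bullet> (x - y))"
proof -
  define h where "h z = f z - \<mu> / 2 * (z \<bullet> z)" for z
  define r where "r z = g z - \<mu> *\<^sub>R z" for z
  have expand: "\<mu> / 2 * (norm (b - a))\<^sup>2 = \<mu> / 2 * (b \<bullet> b) - \<mu> / 2 * (a \<bullet> a) - \<mu> * (a \<bullet> (b - a))" for a b
    by (simp add: power2_norm_eq_inner inner_diff_left inner_diff_right inner_commute algebra_simps)
  have convex: "h a + r a \<bullet> (b - a) \<le> h b" for a b
    using above_tangent[of a b] expand[of b a] unfolding h_def r_def
    by (simp only: inner_diff_left inner_scaleR_left)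
  have upper: "h b \<le> h a + r a \<bullet> (b - a) + L * (norm (b - a))\<^sup>2" for a b
  proof -
    have "h b \<le> h a + r a \<bullet> (b - a) + (L - \<mu> / 2) * (norm (b - a))\<^sup>2 - \<mu> / 2 * (norm (b - a))\<^sup>2"
      using quadratic_upper_bound[of b a] expand[of b a] unfolding h_def r_def
      by (simp only: inner_diff_left inner_scaleR_left)
    also have "\<dots> \<le> h a + r a \<bullet> (b - a) + L * (norm (b - a))\<^sup>2"
      using mu_pos by (simp add: algebra_simps)
    finally show ?thesis .
  qed
  have gap: "h a + r a \<bullet> (b - a) + (norm (r b - r a))\<^sup>2 / (4 * L) \<le> h b" for a b
  proof -
    define d where "d = r b - r a"
    \<comment> \<open>the point where the quadratic upper bound around \<open>b\<close>, tilted by \<open>- r a\<close>, is smallest\<close>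
    define c where "c = b - (1 / (2 * L)) *\<^sub>R d"
    have "h a + r a \<bullet> (c - a) \<le> h b + r b \<bullet> (c - b) + L * (norm (c - b))\<^sup>2"
      using convex[of a c] upper[of c b] by linarith
    moreover have "L * (norm (c - b))\<^sup>2 = (norm d)\<^sup>2 / (4 * L)"
      using \<open>L > 0\<close> unfolding c_def by (simp add: power2_eq_square field_simps)
    moreover have "r a \<bullet> (c - a) - r b \<bullet> (c - b) = r a \<bullet> (b - a) + (norm d)\<^sup>2 / (2 * L)"
    proof -
      have "c - a = (b - a) - (1 / (2 * L)) *\<^sub>R d" "c - b = - ((1 / (2 * L)) *\<^sub>R d)"
        by (simp_all add: c_def)
      moreover have "(norm d)\<^sup>2 = r b \<bullet> d - r a \<bullet> d"
        unfolding power2_norm_eq_inner by (simp add: d_def inner_diff_left)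
      ultimately show ?thesis by (simp add: inner_diff_right diff_divide_distrib)
    qed
    moreover have "(norm d)\<^sup>2 / (2 * L) = 2 * ((norm d)\<^sup>2 / (4 * L))"
      using \<open>L > 0\<close> by simp
    ultimately show ?thesis unfolding d_def by linarith
  qed
  have "u = r x - r y" by (simp add: u_def r_def algebra_simps)
  then have "(norm u)\<^sup>2 / (4 * L) + (norm u)\<^sup>2 / (4 * L) \<le> u \<bullet> (x - y)"
    using gap[of x y] gap[of y x] norm_minus_commute[of "r x" "r y"]
    by (simp add: inner_diff_left inner_diff_right)
  moreover have "(norm u)\<^sup>2 / (4 * L) + (norm u)\<^sup>2 / (4 * L) = (norm u)\<^sup>2 / (2 * L)"
    by simp
  ultimately show ?thesis using \<open>L > 0\<close> by (simp add: pos_divide_le_eq mult.commute)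
qed

text \<open>
  With \<open>u\<close> the difference of the shifted gradients, the step maps \<open>d\<close> to \<open>(1 - t * \<mu>) d - t u\<close>.
  By cocoercivity the term in \<open>\<parallel>u\<parallel>\<^sup>2\<close> of its squared norm is absorbed by the cross term.
\<close>

lemma gradient_step_contraction:
  assumes t: "0 \<le> t" "t * (L + \<mu>) \<le> 1" and "L > 0"
  shows "norm ((x - t *\<^sub>R g x) - (y - t *\<^sub>R g y)) \<le> (1 - t * \<mu>) * norm (x - y)"
proof -
  define d where "d = x - y"
  define u where "u = (g x - g y) - \<mu> *\<^sub>R (x - y)"
  have t\<mu>: "0 \<le> 1 - t * \<mu>"
    using t \<open>L > 0\<close> by (smt (verit) mult_nonneg_nonneg distrib_left)
  have coco: "(norm u)\<^sup>2 \<le> 2 * L * (u \<bullet> d)"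
    unfolding u_def d_def by (rule cocoercive_shifted[OF \<open>L > 0\<close>])
  have ud: "0 \<le> u \<bullet> d"
    using coco \<open>L > 0\<close> by (smt (verit) zero_le_power2 zero_le_mult_iff)
  have step: "(x - t *\<^sub>R g x) - (y - t *\<^sub>R g y) = (1 - t * \<mu>) *\<^sub>R d - t *\<^sub>R u"
    by (simp add: u_def d_def algebra_simps)
  have "(norm ((1 - t * \<mu>) *\<^sub>R d - t *\<^sub>R u))\<^sup>2
      = ((1 - t * \<mu>) * norm d)\<^sup>2 - 2 * t * (1 - t * \<mu>) * (u \<bullet> d) + t * (t * (norm u)\<^sup>2)"
    unfolding power_mult_distrib power2_norm_eq_inner
    by (simp add: inner_diff_left inner_diff_right inner_commute power2_eq_square algebra_simps)
  moreover have "t * (t * (norm u)\<^sup>2) \<le> t * (t * (2 * L * (u \<bullet> d)))"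
    using coco t(1) by (intro mult_left_mono) auto
  moreover have "t * (t * (2 * L * (u \<bullet> d))) \<le> 2 * t * (1 - t * \<mu>) * (u \<bullet> d)"
  proof -
    have "t * L \<le> 1 - t * \<mu>" using t(2) by (simp add: algebra_simps)
    then have "(t * L) * (2 * t * (u \<bullet> d)) \<le> (1 - t * \<mu>) * (2 * t * (u \<bullet> d))"
      using t(1) ud by (intro mult_right_mono) auto
    then show ?thesis by (simp add: mult_ac)
  qed
  ultimately have "(norm ((x - t *\<^sub>R g x) - (y - t *\<^sub>R g y)))\<^sup>2 \<le> ((1 - t * \<mu>) * norm d)\<^sup>2"
    unfolding step by linarith
  then show ?thesis
    unfolding d_def by (rule power2_le_imp_le) (use t\<mu> in simp)
qed

end


lemma strongly_convex_stationary_point: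
  fixes f :: "'a::euclidean_space \<Rightarrow> real"
  assumes scs: "strongly_convex_smooth f g L \<mu>" and cont: "continuous_on UNIV f"
  shows "\<exists>z. g z = 0"
proof -
  interpret strongly_convex_smooth f g L \<mu> by fact
  \<comment> \<open>outside the ball of this radius the quadratic term of the lower bound at \<open>0\<close> dominates,
    so \<open>f\<close> exceeds \<open>f 0\<close> there\<close>
  define R where "R = 2 * norm (g 0) / \<mu>"
  have R: "R \<ge> 0" using mu_pos by (simp add: R_def)
  obtain z where z: "z \<in> cball 0 R" "\<And>u. u \<in> cball 0 R \<Longrightarrow> f z \<le> f u"
    using continuous_attains_inf[of "cball 0 R" f] R continuous_on_subset[OF cont] by auto
  have "f z \<le> f u" for u
  proof (cases "norm u \<le> R")
    case False
    have "norm (g 0) * norm u \<le> \<mu> / 2 * norm u * norm u"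
      using False mu_pos by (intro mult_right_mono) (auto simp: R_def field_simps)
    moreover have "- (norm (g 0) * norm u) \<le> g 0 \<bullet> u"
      using Cauchy_Schwarz_ineq2[of "g 0" u] by linarith
    ultimately have "f 0 \<le> f u"
      using above_tangent[of 0 u] by (simp add: power2_eq_square)
    then show ?thesis using z(2)[of 0] R by simp
  qed (use z in auto)
  then show ?thesis using gradient_zero_at_minimum by blast
qed

lemma strongly_convex_smooth_weaken:
  assumes "strongly_convex_smooth f g L \<mu>" and "L \<le> L'" "0 < \<mu>'" "\<mu>' \<le> \<mu>"
  shows "strongly_convex_smooth f g L' \<mu>'"
proof
  interpret strongly_convex_smooth f g L \<mu> by fact
  show "0 < \<mu>'" by fact
  fix x y
  show "f x + g x \<bullet> (y - x) + \<mu>' / 2 * (norm (y - x))\<^sup>2 \<le> f y"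
    using above_tangent[of x y] mult_right_mono[of "\<mu>' / 2" "\<mu> / 2" "(norm (y - x))\<^sup>2"] assms
    by simp
  show "norm (g x - g y) \<le> L' * norm (x - y)"
    using gradient_lipschitz[of x y] mult_right_mono[OF assms(2) norm_ge_zero[of "x - y"]] by linarith
qed

section \<open>The spectral gap of the mixing matrix\<close>

lemma poly_charpoly: "poly (charpoly A) t = Determinants.det (Finite_Cartesian_Product.mat t - A)"
  unfolding charpoly_def Determinants.det_def
  by (simp add: poly_sum poly_prod Finite_Cartesian_Product.mat_def if_distrib[of "\<lambda>p. poly p t"]
      if_distrib[of "\<lambda>p. poly (p - _) t"] cong: if_cong)

lemma poly_charpoly_eq_0_iff:
  fixes A :: "real^'n^'n"
  shows "poly (charpoly A) t = 0 \<longleftrightarrow> (\<exists>v. v \<noteq> 0 \<and> A *v v = t *\<^sub>R v)"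
proof -
  have "Finite_Cartesian_Product.mat t *v v = t *\<^sub>R v" for v :: "real^'n"
    unfolding Finite_Cartesian_Product.vec_eq_iff
    by (simp add: matrix_vector_mult_def Finite_Cartesian_Product.mat_def
        if_distrib[of "\<lambda>c. c * _"] cong: if_cong)
  then have "(Finite_Cartesian_Product.mat t - A) *v v = t *\<^sub>R v - A *v v" for v :: "real^'n"
    by (simp add: matrix_vector_mult_diff_rdistrib)
  then have "(Finite_Cartesian_Product.mat t - A) *v v = 0 \<longleftrightarrow> A *v v = t *\<^sub>R v" for v :: "real^'n"
    by auto
  then have "(\<exists>v. v \<noteq> 0 \<and> A *v v = t *\<^sub>R v) \<longleftrightarrow> \<not> invertible (Finite_Cartesian_Product.mat t - A)"
    unfolding invertible_left_inverse matrix_left_invertible_ker by auto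
  then show ?thesis by (simp add: poly_charpoly invertible_det_nz)
qed

lemma square_weighted_mean_le:
  fixes w a :: "'n::finite \<Rightarrow> real"
  assumes "\<And>j. w j \<ge> 0" and "sum w UNIV = 1"
  shows "(\<Sum>j\<in>UNIV. w j * a j)\<^sup>2 \<le> (\<Sum>j\<in>UNIV. w j * (a j)\<^sup>2)"
proof -
  define m where "m = (\<Sum>j\<in>UNIV. w j * a j)"
  have "0 \<le> (\<Sum>j\<in>UNIV. w j * (a j - m)\<^sup>2)"
    using assms(1) by (intro sum_nonneg) simp
  also have "\<dots> = (\<Sum>j\<in>UNIV. w j * (a j)\<^sup>2 - 2 * m * (w j * a j) + m\<^sup>2 * w j)"
    by (intro sum.cong) (auto simp: power2_eq_square algebra_simps)
  also have "\<dots> = (\<Sum>j\<in>UNIV. w j * (a j)\<^sup>2) - 2 * m * m + m\<^sup>2"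
    by (simp add: sum.distrib sum_subtractf sum_distrib_left[symmetric] assms(2) m_def)
  finally show ?thesis by (simp add: m_def power2_eq_square)
qed

lemma norm_sq_rows:
  fixes X :: "'a::real_normed_vector^'n"
  shows "(norm X)\<^sup>2 = (\<Sum>i\<in>UNIV. (norm (X $ i))\<^sup>2)"
  by (simp add: norm_vec_def L2_set_def sum_nonneg)

lemma norm_sq_columns:
  fixes X :: "real^'p^'n"
  shows "(norm X)\<^sup>2 = (\<Sum>j\<in>UNIV. (norm (column j X))\<^sup>2)"
  unfolding norm_sq_rows by (simp add: column_def) (rule sum.swap)

lemma column_matrix_matrix_mult: "column j (A ** X) = A *v column j X"
  by (simp add: column_def matrix_matrix_mult_def matrix_vector_mult_def)

lemma norm_matrix_matrix_mult_le:
  fixes A :: "real^'m^'n" and X :: "real^'p^'m"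
  assumes "c \<ge> 0" and "\<And>j. norm (A *v column j X) \<le> c * norm (column j X)"
  shows "norm (A ** X) \<le> c * norm X"
proof (rule power2_le_imp_le)
  have "(norm (A ** X))\<^sup>2 \<le> (\<Sum>j\<in>UNIV. (c * norm (column j X))\<^sup>2)"
    unfolding norm_sq_columns[of "A ** X"] column_matrix_matrix_mult
    by (intro sum_mono power_mono assms) auto
  also have "\<dots> = (c * norm X)\<^sup>2"
    by (simp add: power_mult_distrib norm_sq_columns[of X] sum_distrib_left)
  finally show "(norm (A ** X))\<^sup>2 \<le> (c * norm X)\<^sup>2" .
qed (use assms(1) in simp)

lemma norm_matrix_matrix_mult_le_spectral_norm:
  fixes A :: "real^'m^'n" and X :: "real^'p^'m"
  shows "norm (A ** X) \<le> spectral_norm A * norm X"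
  unfolding spectral_norm_def
  by (intro norm_matrix_matrix_mult_le onorm onorm_pos_le matrix_vector_mul_bounded_linear)

locale mixing =
  fixes E :: "('n::finite \<times> 'n) set" and W :: "real^'n^'n"
  assumes connected: "undirected_connected E" and mixing: "mixing_matrix E W"
begin

lemma weight_nonneg: "W $ i $ j \<ge> 0"
  using mixing unfolding mixing_matrix_def by (metis less_eq_real_def)

lemma weight_pos: "(j, i) \<in> E \<Longrightarrow> W $ i $ j > 0"
  using mixing unfolding mixing_matrix_def nbhd_def by (metis (mono_tags, lifting) UnCI mem_Collect_eq)

lemma weight_zero: "j \<notin> nbhd E i \<Longrightarrow> W $ i $ j = 0"
  using mixing unfolding mixing_matrix_def by metis

lemma row_sum: "(\<Sum>j\<in>UNIV. W $ i $ j) = 1"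
  and column_sum: "(\<Sum>i\<in>UNIV. W $ i $ j) = 1"
  and symmetric: "Finite_Cartesian_Product.transpose W = W"
  using mixing unfolding mixing_matrix_def by auto

lemma inner_mult_swap: "(W *v u) \<bullet> v = u \<bullet> (W *v v)"
  by (metis dot_lmul_matrix symmetric transpose_matrix_vector)

lemma sum_mult: "(\<Sum>i\<in>UNIV. (W *v v) $ i) = (\<Sum>i\<in>UNIV. v $ i)"
proof -
  have "(\<Sum>i\<in>UNIV. (W *v v) $ i) = (\<Sum>j\<in>UNIV. \<Sum>i\<in>UNIV. W $ i $ j * v $ j)"
    unfolding matrix_vector_mult_def by simp (rule sum.swap)
  then show ?thesis by (simp add: sum_distrib_right[symmetric] column_sum)
qed

lemma norm_mult_le: "norm (W *v v) \<le> norm v"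
proof (rule power2_le_imp_le)
  have "(norm (W *v v))\<^sup>2 = (\<Sum>i\<in>UNIV. (\<Sum>j\<in>UNIV. W $ i $ j * v $ j)\<^sup>2)"
    by (simp add: norm_sq_rows matrix_vector_mult_def)
  also have "\<dots> \<le> (\<Sum>i\<in>UNIV. \<Sum>j\<in>UNIV. W $ i $ j * (v $ j)\<^sup>2)"
    by (intro sum_mono square_weighted_mean_le weight_nonneg row_sum)
  also have "\<dots> = (\<Sum>j\<in>UNIV. \<Sum>i\<in>UNIV. W $ i $ j * (v $ j)\<^sup>2)"
    by (rule sum.swap)
  also have "\<dots> = (norm v)\<^sup>2"
    by (simp add: sum_distrib_right[symmetric] column_sum norm_sq_rows)
  finally show "(norm (W *v v))\<^sup>2 \<le> (norm v)\<^sup>2" .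
qed simp

text \<open>
  The maximum principle: where \<open>v\<close> is maximal its value is a weighted mean of the neighbouring
  values, so all neighbours are maximal too; connectivity spreads this over the whole graph.
\<close>

lemma fixed_vector_constant:
  assumes fixed: "W *v v = v"
  shows "v $ i = v $ j"
proof -
  have "Max (range (($) v)) \<in> range (($) v)" by (intro Max_in) auto
  then obtain m where "Max (range (($) v)) = v $ m" by blast
  then have m: "v $ l \<le> v $ m" for l
    using Max_ge[of "range (($) v)" "v $ l"] by simp
  have "v $ l = v $ m" for l
  proof -
    have "(m, l) \<in> E\<^sup>*" using connected unfolding undirected_connected_def by blast
    then show ?thesis
    proof induction
      case (step k l)
      have "(\<Sum>j\<in>UNIV. W $ k $ j * (v $ k - v $ j)) = v $ k - (W *v v) $ k"
        by (simp add: right_diff_distrib sum_subtractf sum_distrib_right[symmetric] row_sum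
            matrix_vector_mult_def)
      then have "(\<Sum>j\<in>UNIV. W $ k $ j * (v $ k - v $ j)) = 0" by (simp add: fixed)
      then have "W $ k $ l * (v $ k - v $ l) = 0"
        using m by (subst (asm) sum_nonneg_eq_0_iff) (auto simp: step.IH weight_nonneg)
      moreover have "W $ k $ l > 0"
        using step.hyps connected by (auto simp: undirected_connected_def intro!: weight_pos dest: symD)
      ultimately show ?case by (simp add: step.IH)
    qed simp
  qed
  then show ?thesis by metis
qed

text \<open>
  All eigenvalues of \<open>W\<close> lie in \<open>[-1, 1]\<close> and \<open>1\<close> is one of them, so \<open>1\<close> heads the list of
  eigenvalues. Any other value sits at a later position, hence between \<open>\<lambda>\<^sub>n\<close> and \<open>\<lambda>\<^sub>2\<close>.
\<close>

lemma eigenvalue_le_mixing_rate: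
  assumes root: "poly (charpoly W) t = 0" and "t \<noteq> 1"
  shows "\<bar>t\<bar> \<le> mixing_rate W"
proof -
  define es where "es = eigenvalues_desc W"
  have le1: "\<bar>s\<bar> \<le> 1" if s: "poly (charpoly W) s = 0" for s
  proof -
    obtain v where v: "v \<noteq> 0" "W *v v = s *\<^sub>R v"
      using s unfolding poly_charpoly_eq_0_iff by blast
    have "\<bar>s\<bar> * norm v \<le> 1 * norm v" using norm_mult_le[of v] v(2) by simp
    then show ?thesis using v(1) by simp
  qed
  have "charpoly W \<noteq> 0" using le1[of 2] by auto
  then have set_es: "set es = {s. poly (charpoly W) s = 0}"
    by (simp add: es_def eigenvalues_desc_def)
  have sorted_es: "sorted (rev es)"
    by (simp add: es_def eigenvalues_desc_def)
  have "W *v (\<chi> i. 1) = 1 *\<^sub>R (\<chi> i. 1)"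
    by (simp add: matrix_vector_mult_def row_sum)
  moreover have "(\<chi> i. 1) \<noteq> (0 :: real^'n)" by (simp add: Finite_Cartesian_Product.vec_eq_iff)
  ultimately have "1 \<in> set es"
    unfolding set_es poly_charpoly_eq_0_iff mem_Collect_eq by blast
  then obtain l where l: "l < length es" "es ! l = 1" by (meson in_set_conv_nth)
  have "es ! 0 \<in> set es" using l(1) by (intro nth_mem) linarith
  then have "es ! 0 = 1"
    using sorted_rev_nth_mono[OF sorted_es, of 0 l] l le1[of "es ! 0"] unfolding set_es by auto
  have "t \<in> set es" using root by (simp add: set_es)
  then obtain k where k: "k < length es" "es ! k = t" by (meson in_set_conv_nth)
  with \<open>es ! 0 = 1\<close> have "1 \<le> k" using \<open>t \<noteq> 1\<close> by (cases k) auto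
  then have "t \<le> es ! 1" using sorted_rev_nth_mono[OF sorted_es, of 1 k] k by simp
  moreover have "last es \<le> t"
    using sorted_rev_nth_mono[OF sorted_es, of k "length es - 1"] k
    by (subst last_conv_nth) auto
  ultimately show ?thesis unfolding mixing_rate_def es_def[symmetric] by linarith
qed

text \<open>
  A variational argument replaces the spectral theorem. Let \<open>M\<close> be the maximum of \<open>\<parallel>W u\<parallel>\<close> on the
  unit sphere of the zero-sum space. At a maximizer, \<open>W\<^sup>2 u = M\<^sup>2 u\<close>, and factoring
  \<open>W\<^sup>2 - M\<^sup>2 = (W - M) (W + M)\<close> produces an eigenvector of zero sum for \<open>M\<close> or for \<open>- M\<close>. A fixed
  vector of \<open>W\<close> is constant and cannot have zero sum, so the eigenvalue is not \<open>1\<close>.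
\<close>

lemma norm_mult_le_mixing_rate:
  assumes sum0: "(\<Sum>i\<in>UNIV. v $ i) = 0"
  shows "norm (W *v v) \<le> mixing_rate W * norm v"
proof (cases "v = 0")
  case False
  define S where "S = sphere 0 1 \<inter> {u :: real^'n. (\<Sum>i\<in>UNIV. u $ i) = 0}"
  have "closed {u :: real^'n. (\<Sum>i\<in>UNIV. u $ i) = 0}"
    by (intro closed_Collect_eq continuous_intros)
  then have "compact S" unfolding S_def by (intro compact_Int_closed compact_sphere)
  moreover have "(1 / norm v) *\<^sub>R v \<in> S"
    using False sum0 by (simp add: S_def sum_divide_distrib[symmetric])
  moreover have "continuous_on S (\<lambda>u. norm (W *v u))"
    by (intro continuous_intros linear_continuous_on matrix_vector_mul_bounded_linear)
  ultimately obtain u where u: "u \<in> S" and max: "\<And>z. z \<in> S \<Longrightarrow> norm (W *v z) \<le> norm (W *v u)"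
    using continuous_attains_sup[of S "\<lambda>u. norm (W *v u)"] by blast
  define M where "M = norm (W *v u)"
  have "M \<ge> 0" by (simp add: M_def)
  have bound: "norm (W *v z) \<le> M * norm z" if "(\<Sum>i\<in>UNIV. z $ i) = 0" for z
  proof (cases "z = 0")
    case False
    then have "(1 / norm z) *\<^sub>R z \<in> S"
      using that by (simp add: S_def sum_divide_distrib[symmetric])
    from max[OF this] show ?thesis
      using False by (simp add: M_def matrix_vector_mult_scaleR field_simps)
  qed simp
  have u_unit: "norm u = 1" and u_sum: "(\<Sum>i\<in>UNIV. u $ i) = 0"
    using u by (auto simp: S_def)
  have "u \<noteq> 0" using u_unit by auto
  have square: "W *v (W *v u) = M\<^sup>2 *\<^sub>R u"
  proof -
    have "norm (W *v (W *v u)) \<le> M * M"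
      using bound[of "W *v u"] by (simp add: sum_mult u_sum M_def)
    then have "(norm (W *v (W *v u)))\<^sup>2 \<le> (M * M)\<^sup>2" by (intro power_mono) auto
    moreover have "(W *v (W *v u)) \<bullet> u = M\<^sup>2"
      by (simp add: inner_mult_swap M_def power2_norm_eq_inner)
    moreover have "(norm (W *v (W *v u) - M\<^sup>2 *\<^sub>R u))\<^sup>2
        = (norm (W *v (W *v u)))\<^sup>2 - 2 * M\<^sup>2 * ((W *v (W *v u)) \<bullet> u) + (M\<^sup>2)\<^sup>2 * (norm u)\<^sup>2"
      unfolding power2_norm_eq_inner
      by (simp add: inner_diff_left inner_diff_right inner_commute power2_eq_square algebra_simps)
    ultimately have "(norm (W *v (W *v u) - M\<^sup>2 *\<^sub>R u))\<^sup>2 \<le> 0"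
      by (simp add: u_unit power2_eq_square)
    then show ?thesis by simp
  qed
  obtain t z where t: "\<bar>t\<bar> = M" and z: "z \<noteq> 0" "(\<Sum>i\<in>UNIV. z $ i) = 0" "W *v z = t *\<^sub>R z"
  proof (cases "W *v u + M *\<^sub>R u = 0")
    case True
    then have "W *v u = (- M) *\<^sub>R u" by (simp add: eq_neg_iff_add_eq_0)
    then show ?thesis using that[of "- M" u] \<open>u \<noteq> 0\<close> u_sum \<open>M \<ge> 0\<close> by simp
  next
    case False
    have "W *v (W *v u + M *\<^sub>R u) = M *\<^sub>R (W *v u + M *\<^sub>R u)"
      by (simp add: matrix_vector_right_distrib matrix_vector_mult_scaleR square
          scaleR_add_right power2_eq_square add.commute)
    moreover have "(\<Sum>i\<in>UNIV. (W *v u + M *\<^sub>R u) $ i) = 0"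
      by (simp add: sum.distrib sum_mult u_sum sum_distrib_left[symmetric])
    ultimately show ?thesis using that[of M "W *v u + M *\<^sub>R u"] False \<open>M \<ge> 0\<close> by simp
  qed
  have "t \<noteq> 1"
  proof
    assume "t = 1"
    then have const: "z $ i = z $ j" for i j using fixed_vector_constant[of z] z(3) by simp
    have "(\<Sum>i\<in>UNIV. z $ i) = (\<Sum>i\<in>(UNIV :: 'n set). z $ j)" for j
      by (rule sum.cong[OF refl const])
    then show False using z(1,2) by (auto simp: Finite_Cartesian_Product.vec_eq_iff)
  qed
  then have "M \<le> mixing_rate W"
    using eigenvalue_le_mixing_rate[of t] z t poly_charpoly_eq_0_iff[of W t] by blast
  then show ?thesis
    using bound[OF sum0] mult_right_mono[OF _ norm_ge_zero[of v], of M] by fastforce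
qed simp

end

section \<open>Stacked iterates: row means and deviations\<close>

definition row_mean :: "'a::real_vector^'n \<Rightarrow> 'a" where
  "row_mean X = (1 / real CARD('n)) *\<^sub>R (\<Sum>i\<in>UNIV. X $ i)"

definition deviation :: "'a::real_vector^'n \<Rightarrow> 'a^'n" where
  "deviation X = X - (\<chi> i. row_mean X)"

lemma row_mean_add: "row_mean (X + Y) = row_mean X + row_mean Y"
  and row_mean_diff: "row_mean (X - Y) = row_mean X - row_mean Y"
  by (simp_all add: row_mean_def sum.distrib sum_subtractf scaleR_add_right scaleR_diff_right)

lemma deviation_add: "deviation (X + Y) = deviation X + deviation Y"
  and deviation_diff: "deviation (X - Y) = deviation X - deviation Y"
  by (simp_all add: deviation_def row_mean_add row_mean_diff Finite_Cartesian_Product.vec_eq_iff)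

lemma norm_const_rows:
  fixes z :: "'a::real_normed_vector"
  shows "norm (\<chi> i::'n::finite. z) = sqrt (real CARD('n)) * norm z"
  by (simp add: norm_vec_def L2_set_def real_sqrt_mult)

lemma norm_le_rows:
  fixes X :: "'a::real_normed_vector^'n" and Y :: "'b::real_normed_vector^'n"
  assumes "c \<ge> 0" and "\<And>i. norm (Y $ i) \<le> c * norm (X $ i)"
  shows "norm Y \<le> c * norm X"
proof (rule power2_le_imp_le)
  have "(norm Y)\<^sup>2 \<le> (\<Sum>i\<in>UNIV. (c * norm (X $ i))\<^sup>2)"
    unfolding norm_sq_rows[of Y] by (intro sum_mono power_mono assms) auto
  also have "\<dots> = (c * norm X)\<^sup>2"
    by (simp add: power_mult_distrib norm_sq_rows[of X] sum_distrib_left)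
  finally show "(norm Y)\<^sup>2 \<le> (c * norm X)\<^sup>2" .
qed (use assms(1) in simp)

text \<open>
  Pythagoras: deviations are orthogonal to stacks with equal rows.
\<close>

lemma norm_sq_deviation_row_mean:
  fixes X :: "'a::real_inner^'n"
  shows "(norm X)\<^sup>2 = (norm (deviation X))\<^sup>2 + (sqrt (real CARD('n)) * norm (row_mean X))\<^sup>2"
proof -
  let ?n = "real CARD('n)"
  have "(norm (deviation X))\<^sup>2
      = (\<Sum>i\<in>UNIV. (norm (X $ i))\<^sup>2 - 2 * (X $ i \<bullet> row_mean X) + (norm (row_mean X))\<^sup>2)"
    unfolding norm_sq_rows power2_norm_eq_inner deviation_def
    by (intro sum.cong) (simp_all add: inner_diff_left inner_diff_right inner_commute)
  also have "\<dots> = (norm X)\<^sup>2 - 2 * ((\<Sum>i\<in>UNIV. X $ i) \<bullet> row_mean X) + ?n * (norm (row_mean X))\<^sup>2"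
    by (simp add: sum.distrib sum_subtractf norm_sq_rows[of X] inner_sum_left sum_distrib_left)
  also have "(\<Sum>i\<in>UNIV. X $ i) = ?n *\<^sub>R row_mean X" by (simp add: row_mean_def)
  finally show ?thesis by (simp add: power2_norm_eq_inner power_mult_distrib)
qed

lemma norm_deviation_le: "norm (deviation X) \<le> norm X"
  for X :: "'a::real_inner^'n"
proof (rule power2_le_imp_le)
  show "(norm (deviation X))\<^sup>2 \<le> (norm X)\<^sup>2"
    unfolding norm_sq_deviation_row_mean[of X] by simp
qed simp

lemma norm_row_mean_le: "norm (row_mean X) \<le> norm X / sqrt (real CARD('n))"
  for X :: "'a::real_inner^'n"
proof -
  have "sqrt (real CARD('n)) * norm (row_mean X) \<le> norm X"
  proof (rule power2_le_imp_le)
    show "(sqrt (real CARD('n)) * norm (row_mean X))\<^sup>2 \<le> (norm X)\<^sup>2"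
      unfolding norm_sq_deviation_row_mean[of X] by simp
  qed simp
  then show ?thesis by (simp add: le_divide_eq mult.commute)
qed

lemma matrix_matrix_mult_row: "(A ** X) $ i = (\<Sum>j\<in>UNIV. (A $ i $ j) *\<^sub>R (X $ j))"
  for A :: "real^'m^'n" and X :: "real^'p^'m"
  by (simp add: matrix_matrix_mult_def Finite_Cartesian_Product.vec_eq_iff)

lemma matrix_mult_diff_right: "A ** (X - Y) = A ** X - A ** Y"
  for A :: "real^'m^'n" and X :: "real^'p^'m"
  by (simp add: matrix_matrix_mult_def Finite_Cartesian_Product.vec_eq_iff right_diff_distrib sum_subtractf)

lemma matrix_mult_diff_left: "(A - B) ** X = A ** X - B ** X"
  for A :: "real^'m^'n" and X :: "real^'p^'m"
  by (simp add: matrix_matrix_mult_def Finite_Cartesian_Product.vec_eq_iff left_diff_distrib sum_subtractf)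

context mixing
begin

lemma mult_const_rows: "W ** (\<chi> i. z) = (\<chi> i. z)"
  unfolding Finite_Cartesian_Product.vec_eq_iff[of "W ** _"]
  by (simp add: matrix_matrix_mult_row scaleR_left.sum[symmetric] row_sum)

lemma row_mean_mult: "row_mean (W ** X) = row_mean X"
proof -
  have "(\<Sum>i\<in>UNIV. (W ** X) $ i) = (\<Sum>j\<in>UNIV. \<Sum>i\<in>UNIV. (W $ i $ j) *\<^sub>R (X $ j))"
    unfolding matrix_matrix_mult_row by (rule sum.swap)
  then show ?thesis by (simp add: row_mean_def scaleR_left.sum[symmetric] column_sum)
qed

lemma deviation_mult: "deviation (W ** X) = W ** deviation X"
  by (simp add: deviation_def row_mean_mult matrix_mult_diff_right mult_const_rows)

lemma norm_matrix_mult_le: "norm (W ** X) \<le> norm X"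
  using norm_matrix_matrix_mult_le[of 1 W X] norm_mult_le by simp

lemma norm_deviation_mult_le:
  assumes "mixing_rate W \<ge> 0"
  shows "norm (deviation (W ** X)) \<le> mixing_rate W * norm (deviation X)"
  unfolding deviation_mult
proof (rule norm_matrix_matrix_mult_le[OF assms norm_mult_le_mixing_rate])
  fix j
  have "(\<Sum>i\<in>UNIV. X $ i) = real CARD('n) *\<^sub>R row_mean X" by (simp add: row_mean_def)
  from arg_cong[OF this, of "\<lambda>v. v $ j"]
  show "(\<Sum>i\<in>UNIV. column j (deviation X) $ i) = 0"
    by (simp add: column_def deviation_def sum_subtractf)
qed

end

section \<open>Recursive inequalities with a nonnegative matrix\<close>

text \<open>
  Entries are given by a real function so that entrywise inequalities can be stated; the spectral
  radius is that of the complexification.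
\<close>

definition complex_mat_of :: "nat \<Rightarrow> (nat \<Rightarrow> nat \<Rightarrow> real) \<Rightarrow> complex mat" where
  "complex_mat_of m N = Matrix.mat m m (\<lambda>(i, j). complex_of_real (N i j))"

lemma eigenvalue_complex_mat_of_iff:
  "eigenvalue (complex_mat_of m N) c \<longleftrightarrow>
     (\<exists>z. (\<exists>i<m. z i \<noteq> 0) \<and> (\<forall>i<m. (\<Sum>j<m. of_real (N i j) * z j) = c * z i))"
  (is "?L \<longleftrightarrow> ?R")
proof
  assume ?L
  then obtain v where v: "eigenvector (complex_mat_of m N) v c"
    unfolding eigenvalue_def by blast
  then have dim: "dim_vec v = m" and nz: "v \<noteq> 0\<^sub>v m"
    and eq: "complex_mat_of m N *\<^sub>v v = c \<cdot>\<^sub>v v"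
    unfolding eigenvector_def complex_mat_of_def by auto
  have "\<exists>i<m. vec_index v i \<noteq> 0"
    using nz dim by (metis eq_vecI index_zero_vec)
  moreover have "(\<Sum>j<m. of_real (N i j) * vec_index v j) = c * vec_index v i" if "i < m" for i
    using arg_cong[OF eq, of "\<lambda>u. vec_index u i"] that dim
    by (simp add: complex_mat_of_def scalar_prod_def lessThan_atLeast0)
  ultimately show ?R by blast
next
  assume ?R
  then obtain z where nz: "\<exists>i<m. z i \<noteq> 0"
    and eq: "\<And>i. i < m \<Longrightarrow> (\<Sum>j<m. of_real (N i j) * z j) = c * z i" by blast
  have "eigenvector (complex_mat_of m N) (Matrix.vec m z) c"
    unfolding eigenvector_def
  proof (intro conjI)
    show "Matrix.vec m z \<in> carrier_vec (dim_row (complex_mat_of m N))"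
      by (simp add: complex_mat_of_def)
    show "Matrix.vec m z \<noteq> 0\<^sub>v (dim_row (complex_mat_of m N))"
      using nz by (metis complex_mat_of_def dim_row_mat(1) index_vec index_zero_vec(1))
    show "complex_mat_of m N *\<^sub>v Matrix.vec m z = c \<cdot>\<^sub>v Matrix.vec m z"
      using eq by (intro eq_vecI)
        (simp_all add: complex_mat_of_def scalar_prod_def lessThan_atLeast0)
  qed
  then show ?L unfolding eigenvalue_def by blast
qed

lemma spectral_radius_attained:
  assumes "m > 0"
  shows "\<exists>c. eigenvalue (complex_mat_of m N) c \<and> cmod c = spectral_radius (complex_mat_of m N)"
  using spectral_radius_mem_max(1)[of "complex_mat_of m N" m] assms
  by (auto simp: complex_mat_of_def spectrum_def)

text \<open>
  For an eigenvector \<open>z\<close>, choose the index \<open>i\<close> maximizing \<open>\<bar>z i\<bar> / d i\<close>. In row \<open>i\<close> of the eigenvalue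
  equation all \<open>\<bar>z j\<bar>\<close> are at most this maximal ratio times \<open>d j\<close>, so \<open>N d < d\<close> forces the eigenvalue
  to have modulus below \<open>1\<close>.
\<close>

lemma spectral_radius_less_1_if_subinvariant:
  assumes m: "m > 0"
    and nonneg: "\<And>i j. i < m \<Longrightarrow> j < m \<Longrightarrow> N i j \<ge> 0"
    and d_pos: "\<And>i. i < m \<Longrightarrow> d i > 0"
    and sub: "\<And>i. i < m \<Longrightarrow> (\<Sum>j<m. N i j * d j) < d i"
  shows "spectral_radius (complex_mat_of m N) < 1"
proof -
  obtain c where "eigenvalue (complex_mat_of m N) c"
    and c: "cmod c = spectral_radius (complex_mat_of m N)"
    using spectral_radius_attained[OF m] by blast
  then obtain z where nz: "\<exists>i<m. z i \<noteq> 0"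
    and eq: "\<And>i. i < m \<Longrightarrow> (\<Sum>j<m. of_real (N i j) * z j) = c * z i"
    unfolding eigenvalue_complex_mat_of_iff by blast
  define q where "q i = cmod (z i) / d i" for i
  have fin: "finite (q ` {..<m})" "q ` {..<m} \<noteq> {}" using m by auto
  obtain i where i: "i < m" "q i = Max (q ` {..<m})"
    using Max_in[OF fin] by auto
  have q_le: "q j \<le> q i" if "j < m" for j
    using that fin i(2) by auto
  have zq: "cmod (z j) = q j * d j" if "j < m" for j
    using d_pos[OF that] by (simp add: q_def)
  have qi: "q i > 0"
  proof -
    obtain l where l: "l < m" "z l \<noteq> 0" using nz by blast
    then have "q l > 0" using d_pos by (simp add: q_def)
    then show ?thesis using q_le[OF l(1)] by linarith
  qed
  have "cmod c * (q i * d i) = cmod (\<Sum>j<m. of_real (N i j) * z j)"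
    using eq[OF i(1)] zq[OF i(1)] by (simp add: norm_mult)
  also have "\<dots> \<le> (\<Sum>j<m. N i j * (q j * d j))"
    using nonneg i(1) by (intro order_trans[OF norm_sum] sum_mono) (simp add: norm_mult zq)
  also have "\<dots> \<le> (\<Sum>j<m. N i j * (q i * d j))"
    using nonneg i(1) q_le less_imp_le[OF d_pos]
    by (intro sum_mono mult_left_mono mult_right_mono) auto
  also have "\<dots> = q i * (\<Sum>j<m. N i j * d j)"
    by (simp add: sum_distrib_left mult_ac)
  also have "\<dots> < q i * d i"
    using sub[OF i(1)] qi by simp
  finally have "cmod c * (q i * d i) < 1 * (q i * d i)" by simp
  then have "cmod c < 1" using qi d_pos[OF i(1)] mult_less_cancel_right_pos[of "q i * d i"] by simp
  then show ?thesis by (simp add: c)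
qed

text \<open>
  Nonnegativity of \<open>N\<close> lets the inequality be iterated to \<open>v\<^sub>k \<le> N\<^sup>k v\<^sub>0\<close>, and the powers of a matrix of
  spectral radius below \<open>1\<close> are bounded by its Jordan normal form.
\<close>

lemma recursive_inequality_bounded:
  fixes v :: "nat \<Rightarrow> nat \<Rightarrow> real"
  assumes nonneg: "\<And>i j. i < m \<Longrightarrow> j < m \<Longrightarrow> N i j \<ge> 0"
    and rec: "\<And>k i. i < m \<Longrightarrow> v (Suc k) i \<le> (\<Sum>j<m. N i j * v k j)"
    and radius: "spectral_radius (complex_mat_of m N) < 1"
  shows "\<exists>C. \<forall>k. \<forall>i<m. v k i \<le> C"
proof -
  define A where "A = Matrix.mat m m (\<lambda>(i, j). N i j)"
  have A: "A \<in> carrier_mat m m" by (simp add: A_def)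
  have Ak: "A ^\<^sub>m k \<in> carrier_mat m m" for k using A by simp
  have pow_Suc: "(A ^\<^sub>m Suc k) $$ (i, l) = (\<Sum>j<m. (A ^\<^sub>m k) $$ (i, j) * N j l)"
    if "i < m" "l < m" for k i l
    using that A Ak[of k] by (simp add: scalar_prod_def lessThan_atLeast0 A_def)
  have pow_nonneg: "(A ^\<^sub>m k) $$ (i, j) \<ge> 0" if "i < m" "j < m" for k i j
    using that
  proof (induction k arbitrary: j)
    case 0
    then show ?case using A by auto
  next
    case (Suc k)
    then show ?case using nonneg by (subst pow_Suc) (auto intro!: sum_nonneg)
  qed
  have iterate: "v (l + k) i \<le> (\<Sum>j<m. (A ^\<^sub>m k) $$ (i, j) * v l j)" if "i < m" for k l i
  proof (induction k arbitrary: l)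
    case 0
    have "(\<Sum>j<m. (A ^\<^sub>m 0) $$ (i, j) * v l j) = (\<Sum>j<m. if j = i then v l j else 0)"
      using that A by (intro sum.cong) auto
    then show ?case using that by simp
  next
    case (Suc k)
    have "v (l + Suc k) i \<le> (\<Sum>j<m. (A ^\<^sub>m k) $$ (i, j) * v (Suc l) j)"
      using Suc[of "Suc l"] by simp
    also have "\<dots> \<le> (\<Sum>j<m. (A ^\<^sub>m k) $$ (i, j) * (\<Sum>h<m. N j h * v l h))"
      using that by (intro sum_mono mult_left_mono rec pow_nonneg) auto
    also have "\<dots> = (\<Sum>h<m. (\<Sum>j<m. (A ^\<^sub>m k) $$ (i, j) * N j h) * v l h)"
      unfolding sum_distrib_left sum_distrib_right by (subst sum.swap) (simp add: mult_ac)
    also have "\<dots> = (\<Sum>h<m. (A ^\<^sub>m Suc k) $$ (i, h) * v l h)"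
      using that by (intro sum.cong) (simp_all add: pow_Suc del: pow_mat.simps)
    finally show ?case .
  qed
  have complexify: "complex_mat_of m N = map_mat complex_of_real A"
    by (rule eq_matI) (auto simp: complex_mat_of_def A_def)
  obtain c where c: "\<And>k. norm_bound (complex_mat_of m N ^\<^sub>m k) c"
    using spectral_radius_jnf_norm_bound_less_1_upper_triangular[OF _ radius, of m]
    by (auto simp: complex_mat_of_def)
  have entry: "(A ^\<^sub>m k) $$ (i, j) \<le> c" if "i < m" "j < m" for k i j
  proof -
    have "cmod (complex_of_real ((A ^\<^sub>m k) $$ (i, j))) \<le> c"
      using c[of k] that Ak[of k]
      unfolding norm_bound_def complexify of_real_hom.mat_hom_pow[OF A, symmetric]
      by (metis carrier_matD index_map_mat)
    then show ?thesis by simp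
  qed
  have "v k i \<le> (\<Sum>j<m. c * \<bar>v 0 j\<bar>)" if "i < m" for k i
  proof -
    have "v k i \<le> (\<Sum>j<m. (A ^\<^sub>m k) $$ (i, j) * v 0 j)"
      using iterate[OF that, of 0 k] by simp
    also have "\<dots> \<le> (\<Sum>j<m. c * \<bar>v 0 j\<bar>)"
    proof (rule sum_mono)
      fix j assume "j \<in> {..<m}"
      then show "(A ^\<^sub>m k) $$ (i, j) * v 0 j \<le> c * \<bar>v 0 j\<bar>"
        using mult_left_mono[OF abs_ge_self[of "v 0 j"] pow_nonneg[OF that, of j k]]
          mult_right_mono[OF entry[OF that, of j k] abs_ge_zero[of "v 0 j"]] by auto
    qed
    finally show ?thesis .
  qed
  then show ?thesis by blast
qed

text \<open>
  Dividing \<open>N\<close> by \<open>r\<close> and \<open>v\<^sub>k\<close> by \<open>r\<^sup>k\<close> reduces the claim to a bounded recursion, because scaling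
  scales the eigenvalues.
\<close>

lemma recursive_inequality_geometric_bound:
  fixes v :: "nat \<Rightarrow> nat \<Rightarrow> real"
  assumes m: "m > 0"
    and nonneg: "\<And>i j. i < m \<Longrightarrow> j < m \<Longrightarrow> N i j \<ge> 0"
    and rec: "\<And>k i. i < m \<Longrightarrow> v (Suc k) i \<le> (\<Sum>j<m. N i j * v k j)"
    and r: "spectral_radius (complex_mat_of m N) < r"
  shows "\<exists>C. \<forall>k. \<forall>i<m. v k i \<le> C * r ^ k"
proof -
  have "r > 0"
    using spectral_radius_attained[OF m, of N] r by (smt (verit) norm_ge_zero)
  have "spectral_radius (complex_mat_of m (\<lambda>i j. N i j / r)) < 1"
  proof -
    obtain c where "eigenvalue (complex_mat_of m (\<lambda>i j. N i j / r)) c"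
      and c: "cmod c = spectral_radius (complex_mat_of m (\<lambda>i j. N i j / r))"
      using spectral_radius_attained[OF m] by blast
    then obtain z where nz: "\<exists>i<m. z i \<noteq> 0"
      and eq: "\<And>i. i < m \<Longrightarrow> (\<Sum>j<m. of_real (N i j / r) * z j) = c * z i"
      unfolding eigenvalue_complex_mat_of_iff by blast
    have "(\<Sum>j<m. of_real (N i j) * z j) = (of_real r * c) * z i" if "i < m" for i
    proof -
      have "of_real r * (\<Sum>j<m. of_real (N i j / r) * z j) = (\<Sum>j<m. of_real (N i j) * z j)"
        unfolding sum_distrib_left using \<open>r > 0\<close> by (intro sum.cong) auto
      then show ?thesis using eq[OF that] by (simp only: mult.assoc)
    qed
    then have "eigenvalue (complex_mat_of m N) (of_real r * c)"
      using nz unfolding eigenvalue_complex_mat_of_iff by blast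
    then have "cmod (of_real r * c) \<le> spectral_radius (complex_mat_of m N)"
      using spectral_radius_mem_max(2)[of "complex_mat_of m N" m "cmod (of_real r * c)"] m
      by (auto simp: spectrum_def complex_mat_of_def)
    moreover have "cmod (of_real r * c) = r * cmod c" using \<open>r > 0\<close> by (simp add: norm_mult)
    ultimately have "r * cmod c < r * 1" using r by linarith
    then have "cmod c < 1" using \<open>r > 0\<close> by simp
    then show ?thesis by (simp only: c)
  qed
  moreover have "v (Suc k) i / r ^ Suc k \<le> (\<Sum>j<m. N i j / r * (v k j / r ^ k))" if "i < m" for k i
  proof -
    have "(\<Sum>j<m. N i j / r * (v k j / r ^ k)) = (\<Sum>j<m. N i j * v k j) / r ^ Suc k"
      by (simp add: sum_divide_distrib)
    then show ?thesis using rec[OF that, of k] \<open>r > 0\<close> by (simp add: divide_right_mono)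
  qed
  ultimately obtain C where "\<And>k i. i < m \<Longrightarrow> v k i / r ^ k \<le> C"
    using recursive_inequality_bounded[of m "\<lambda>i j. N i j / r" "\<lambda>k i. v k i / r ^ k"]
      nonneg \<open>r > 0\<close> by auto
  then have "\<forall>k. \<forall>i<m. v k i \<le> C * r ^ k"
    using \<open>r > 0\<close> by (simp add: divide_le_eq)
  then show ?thesis by blast
qed

section \<open>Adaptive stepsizes\<close>

text \<open>
  An update never pushes a stepsize below \<open>1 / (2 * \<gamma> * M)\<close>: the curvature \<open>c k\<close> is at most \<open>M\<close>, and the
  growth factor \<open>sqrt (1 + \<theta> k)\<close> is at least \<open>1\<close>. The upper bound comes from the first branch of the
  minimum and is inherited by steps that keep the stepsize; as the very first update is not of
  this kind, it holds from \<open>\<alpha> 1\<close> on.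
\<close>

lemma stepsize_bounds:
  fixes \<alpha> \<theta> c :: "nat \<Rightarrow> real"
  assumes pos: "\<gamma> > 0" "m > 0"
    and start: "\<alpha> 0 \<ge> 1 / (2 * \<gamma> * M)" "\<theta> 0 = 0" "\<not> stalled 0"
    and update: "\<And>k. \<alpha> (Suc k) = (if stalled k then \<alpha> k
                   else min (1 / (2 * \<gamma> * c k)) (sqrt (1 + \<theta> k) * \<alpha> k))"
    and ratio: "\<And>k. \<theta> (Suc k) = \<alpha> (Suc k) / \<alpha> k"
    and curvature: "\<And>k. \<not> stalled k \<Longrightarrow> m \<le> c k \<and> c k \<le> M"
  shows "1 / (2 * \<gamma> * M) \<le> \<alpha> k" and "\<alpha> (Suc k) \<le> 1 / (2 * \<gamma> * m)"
proof -
  have "M > 0" using curvature[OF start(3)] pos(2) by linarith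
  then have lower_pos: "0 < 1 / (2 * \<gamma> * M)" using pos(1) by simp
  have inv_le: "1 / (2 * \<gamma> * M) \<le> 1 / (2 * \<gamma> * c k)" "1 / (2 * \<gamma> * c k) \<le> 1 / (2 * \<gamma> * m)"
    if "\<not> stalled k" for k
    using curvature[OF that] pos by (auto intro!: divide_left_mono mult_left_mono mult_pos_pos)
  have "1 / (2 * \<gamma> * M) \<le> \<alpha> k \<and> 0 \<le> \<theta> k" for k
  proof (induction k)
    case (Suc k)
    have "0 \<le> \<alpha> k" using Suc lower_pos by linarith
    then have "1 * \<alpha> k \<le> sqrt (1 + \<theta> k) * \<alpha> k"
      using Suc by (intro mult_right_mono) auto
    then have "1 / (2 * \<gamma> * M) \<le> \<alpha> (Suc k)"
      using Suc inv_le(1)[of k] by (auto simp: update)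
    moreover have "0 \<le> \<alpha> (Suc k)" using calculation lower_pos by linarith
    ultimately show ?case using \<open>0 \<le> \<alpha> k\<close> by (simp add: ratio)
  qed (use start in auto)
  then show "1 / (2 * \<gamma> * M) \<le> \<alpha> k" by blast
  show "\<alpha> (Suc k) \<le> 1 / (2 * \<gamma> * m)"
  proof (induction k)
    case 0
    then show ?case using start(3) inv_le(2)[of 0] by (simp add: update min_le_iff_disj)
  next
    case (Suc k)
    then show ?case
      using inv_le(2)[of "Suc k"] update[of "Suc k"] by (cases "stalled (Suc k)") (auto simp: min_le_iff_disj)
  qed
qed

section \<open>One step of gradient tracking\<close>

lemma strongly_convex_smooth_avg_fun:
  fixes f :: "'n::finite \<Rightarrow> 'a::euclidean_space \<Rightarrow> real"
  assumes scs: "\<And>i. strongly_convex_smooth (f i) (g i) L \<mu>"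
  shows "strongly_convex_smooth (avg_fun f) (\<lambda>z. row_mean (\<chi> i. g i z)) L \<mu>"
proof
  show "0 < \<mu>" by (rule strongly_convex_smooth.mu_pos[OF scs])
  fix x y
  let ?n = "real CARD('n)"
  have "(\<Sum>i\<in>(UNIV :: 'n set). f i x + g i x \<bullet> (y - x) + \<mu> / 2 * (norm (y - x))\<^sup>2) \<le> (\<Sum>i\<in>UNIV. f i y)"
    by (intro sum_mono strongly_convex_smooth.above_tangent[OF scs])
  then have "(1 / ?n) * (\<Sum>i\<in>(UNIV :: 'n set). f i x + g i x \<bullet> (y - x) + \<mu> / 2 * (norm (y - x))\<^sup>2)
      \<le> (1 / ?n) * (\<Sum>i\<in>UNIV. f i y)"
    by (intro mult_left_mono) auto
  then show "avg_fun f x + row_mean (\<chi> i. g i x) \<bullet> (y - x) + \<mu> / 2 * (norm (y - x))\<^sup>2 \<le> avg_fun f y"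
    by (simp add: avg_fun_def row_mean_def sum.distrib inner_sum_left add_divide_distrib)
  have "norm (row_mean (\<chi> i. g i x) - row_mean (\<chi> i. g i y))
      \<le> (1 / ?n) * (\<Sum>i\<in>(UNIV :: 'n set). norm (g i x - g i y))"
    unfolding row_mean_diff[symmetric] by (simp add: row_mean_def divide_right_mono norm_sum)
  also have "\<dots> \<le> (1 / ?n) * (\<Sum>i\<in>(UNIV :: 'n set). L * norm (x - y))"
    by (intro mult_left_mono sum_mono strongly_convex_smooth.gradient_lipschitz[OF scs]) auto
  finally show "norm (row_mean (\<chi> i. g i x) - row_mean (\<chi> i. g i y)) \<le> L * norm (x - y)"
    by simp
qed

text \<open>
  Gradient tracking with arbitrary stepsizes. The step estimates below bound one iteration under
  bounds on its stepsizes, which keeps them separate from the adaptive rule.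
\<close>

locale gradient_tracking = mixing E W
  for E :: "('n::finite \<times> 'n) set" and W :: "real^'n^'n" +
  fixes f :: "'n \<Rightarrow> real^'p::finite \<Rightarrow> real" and g :: "'n \<Rightarrow> real^'p \<Rightarrow> real^'p"
    and L \<mu> :: real and x y :: "nat \<Rightarrow> real^'p^'n" and \<alpha> :: "nat \<Rightarrow> 'n \<Rightarrow> real" and xs :: "real^'p"
  assumes scs: "\<And>i. strongly_convex_smooth (f i) (g i) L \<mu>"
    and L_pos: "L > 0"
    and lam_nonneg: "mixing_rate W \<ge> 0"
    and x_step: "\<And>k. x (Suc k) = W ** (x k - (\<chi> i. \<alpha> k i *\<^sub>R (y k $ i)))"
    and y_step: "\<And>k. y (Suc k) = W ** y k + ((\<chi> i. g i (x (Suc k) $ i)) - (\<chi> i. g i (x k $ i)))"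
    and y_init: "y 0 = (\<chi> i. g i (x 0 $ i))"
    and stationary: "row_mean (\<chi> i. g i xs) = 0"
begin

lemmas lipschitz = strongly_convex_smooth.gradient_lipschitz[OF scs]

lemma gradient_stack_lipschitz:
  "norm ((\<chi> i. g i (X $ i)) - (\<chi> i. g i (Y $ i))) \<le> L * norm (X - Y)"
proof (rule norm_le_rows)
  show "norm (((\<chi> i. g i (X $ i)) - (\<chi> i. g i (Y $ i))) $ i) \<le> L * norm ((X - Y) $ i)" for i
    using lipschitz[of i "X $ i" "Y $ i"] by simp
qed (use L_pos in simp)

text \<open>
  The invariant that gives the method its name: mixing preserves means, and each update of \<open>y\<close> adds
  exactly the change of the local gradients.
\<close>

lemma tracking: "row_mean (y k) = row_mean (\<chi> i. g i (x k $ i))"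
  by (induction k) (simp_all add: y_init y_step row_mean_add row_mean_diff row_mean_mult)

lemma norm_minus_const_le:
  "norm (x k - (\<chi> i. z)) \<le> norm (deviation (x k)) + sqrt (real CARD('n)) * norm (row_mean (x k) - z)"
proof -
  have "x k - (\<chi> i. z) = deviation (x k) + (\<chi> i. row_mean (x k) - z)"
    by (simp add: deviation_def Finite_Cartesian_Product.vec_eq_iff)
  then show ?thesis using norm_triangle_ineq norm_const_rows by metis
qed

text \<open>
  The mean of \<open>y\<close> is the mean of the local gradients, which vanishes when all agents sit at the
  minimizer. As \<open>sqrt n\<close> times the norm of a row mean is at most the norm of the stack, the stack with
  all rows equal to the mean of \<open>y\<close> has norm at most \<open>L\<close> times the distance of \<open>x\<close> to that
  configuration.
\<close>

lemma norm_tracker_le: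
  "norm (y k) \<le> L * norm (deviation (x k)) + norm (deviation (y k))
      + sqrt (real CARD('n)) * L * norm (row_mean (x k) - xs)"
proof -
  let ?s = "sqrt (real CARD('n))"
  have "row_mean (y k) = row_mean ((\<chi> i. g i (x k $ i)) - (\<chi> i. g i ((\<chi> i. xs) $ i)))"
    by (simp add: tracking row_mean_diff stationary)
  then have "?s * norm (row_mean (y k)) \<le> norm ((\<chi> i. g i (x k $ i)) - (\<chi> i. g i ((\<chi> i. xs) $ i)))"
    using norm_row_mean_le[of "(\<chi> i. g i (x k $ i)) - (\<chi> i. g i ((\<chi> i. xs) $ i))"]
    by (simp add: le_divide_eq mult.commute)
  also have "\<dots> \<le> L * norm (x k - (\<chi> i. xs))" by (rule gradient_stack_lipschitz)
  also have "\<dots> \<le> L * (norm (deviation (x k)) + ?s * norm (row_mean (x k) - xs))"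
    using L_pos norm_minus_const_le by (intro mult_left_mono) auto
  finally have mean: "?s * norm (row_mean (y k)) \<le> \<dots>" .
  have "y k = deviation (y k) + (\<chi> i. row_mean (y k))" by (simp add: deviation_def)
  then have "norm (y k) \<le> norm (deviation (y k)) + ?s * norm (row_mean (y k))"
    using norm_triangle_ineq norm_const_rows by metis
  then show ?thesis using mean by (simp add: algebra_simps)
qed

context
  fixes k :: nat and a b :: real
  assumes step_le: "\<And>i. \<alpha> k i \<le> a" and step_ge: "\<And>i. b \<le> \<alpha> k i"
    and b_pos: "b > 0" and a_small: "a * (L + \<mu>) \<le> 1"
begin

lemma a_nonneg: "a \<ge> 0"
  using step_le step_ge b_pos by (meson less_le_trans less_imp_le)

lemma norm_scaled_rows_le: "norm (\<chi> i. \<alpha> k i *\<^sub>R (Y $ i)) \<le> a * norm Y"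
  for Y :: "real^'p^'n"
proof (rule norm_le_rows[OF a_nonneg])
  fix i
  have "0 \<le> \<alpha> k i" using step_ge[of i] b_pos by linarith
  then show "norm ((\<chi> i. \<alpha> k i *\<^sub>R (Y $ i)) $ i) \<le> a * norm (Y $ i)"
    using step_le[of i] by (simp add: mult_right_mono)
qed

lemma consensus_error_step:
  "norm (deviation (x (Suc k))) \<le> mixing_rate W * (norm (deviation (x k)) + a * norm (y k))"
proof -
  let ?D = "\<chi> i. \<alpha> k i *\<^sub>R (y k $ i)"
  have "norm (deviation (x k - ?D)) \<le> norm (deviation (x k)) + norm (deviation ?D)"
    unfolding deviation_diff by (rule norm_triangle_ineq4)
  also have "\<dots> \<le> norm (deviation (x k)) + a * norm (y k)"
    using norm_deviation_le[of ?D] norm_scaled_rows_le[of "y k"] by simp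
  finally show ?thesis
    using norm_deviation_mult_le[OF lam_nonneg, of "x k - ?D"] mult_left_mono[OF _ lam_nonneg]
    unfolding x_step by (meson order_trans)
qed

text \<open>
  \<open>W - I\<close> annihilates stacks with equal rows, so apart from the gradient step only the deviation of
  \<open>x\<close> contributes to the movement of \<open>x\<close>, and the movement of \<open>x\<close> bounds the change of the gradients.
\<close>

lemma tracking_error_step:
  "norm (deviation (y (Suc k))) \<le> mixing_rate W * norm (deviation (y k))
     + L * (spectral_norm (W - Finite_Cartesian_Product.mat 1) * norm (deviation (x k)) + a * norm (y k))"
proof -
  let ?D = "\<chi> i. \<alpha> k i *\<^sub>R (y k $ i)"
  let ?I = "Finite_Cartesian_Product.mat 1 :: real^'n^'n"
  let ?G = "(\<chi> i. g i (x (Suc k) $ i)) - (\<chi> i. g i (x k $ i))"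
  have "(W - ?I) ** deviation (x k) = W ** x k - x k"
    by (simp add: deviation_def matrix_mult_diff_left matrix_mult_diff_right mult_const_rows)
  then have "x (Suc k) - x k = (W - ?I) ** deviation (x k) - W ** ?D"
    by (simp add: x_step matrix_mult_diff_right algebra_simps)
  then have "norm (x (Suc k) - x k) \<le> norm ((W - ?I) ** deviation (x k)) + norm (W ** ?D)"
    by (simp only: norm_triangle_ineq4)
  also have "\<dots> \<le> spectral_norm (W - ?I) * norm (deviation (x k)) + a * norm (y k)"
    using norm_matrix_matrix_mult_le_spectral_norm[of "W - ?I" "deviation (x k)"]
      norm_matrix_mult_le[of ?D] norm_scaled_rows_le[of "y k"] by linarith
  finally have move: "norm (x (Suc k) - x k) \<le> \<dots>" .
  have "norm (deviation (y (Suc k))) \<le> norm (deviation (W ** y k)) + norm (deviation ?G)"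
    unfolding y_step deviation_add by (rule norm_triangle_ineq)
  also have "\<dots> \<le> mixing_rate W * norm (deviation (y k)) + L * norm (x (Suc k) - x k)"
    using norm_deviation_mult_le[OF lam_nonneg] norm_deviation_le[of ?G]
      gradient_stack_lipschitz[of "x (Suc k)" "x k"] by (intro add_mono) auto
  also have "\<dots> \<le> mixing_rate W * norm (deviation (y k))
     + L * (spectral_norm (W - ?I) * norm (deviation (x k)) + a * norm (y k))"
    using move L_pos by (intro add_left_mono mult_left_mono) auto
  finally show ?thesis .
qed

text \<open>
  The mean of \<open>x\<close> moves by a gradient step of the average function with the mean stepsize \<open>t\<close>,
  perturbed by two errors: the gradients are evaluated at the agents' own points instead of their
  mean, and unequal stepsizes let the deviation of \<open>y\<close> leak into the mean.
\<close>

lemma optimality_error_step: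
  "norm (row_mean (x (Suc k)) - xs) \<le> L * (a / sqrt (real CARD('n))) * norm (deviation (x k))
     + a / sqrt (real CARD('n)) * norm (deviation (y k)) + (1 - b * \<mu>) * norm (row_mean (x k) - xs)"
proof -
  let ?s = "sqrt (real CARD('n))"
  let ?m = "row_mean (x k)"
  let ?gm = "\<lambda>z. row_mean (\<chi> i. g i z)"
  define t where "t = (1 / real CARD('n)) * (\<Sum>i\<in>UNIV. \<alpha> k i)"
  have t_le: "t \<le> a"
    using sum_mono[of UNIV "\<alpha> k" "\<lambda>_. a"] step_le by (simp add: t_def divide_le_eq mult.commute)
  have t_ge: "b \<le> t"
    using sum_mono[of UNIV "\<lambda>_. b" "\<alpha> k"] step_ge by (simp add: t_def le_divide_eq mult.commute)
  have mu_pos: "\<mu> > 0" by (rule strongly_convex_smooth.mu_pos[OF scs])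
  have split: "row_mean (\<chi> i. \<alpha> k i *\<^sub>R (y k $ i))
      = t *\<^sub>R row_mean (y k) + row_mean (\<chi> i. \<alpha> k i *\<^sub>R (deviation (y k) $ i))"
    by (simp add: row_mean_def[of "\<chi> i. _ i"] deviation_def t_def scaleR_diff_right sum_subtractf
        scaleR_left.sum[symmetric] scaleR_sum_left[symmetric])
  have "norm ((?m - t *\<^sub>R ?gm ?m) - (xs - t *\<^sub>R ?gm xs)) \<le> (1 - t * \<mu>) * norm (?m - xs)"
  proof (rule strongly_convex_smooth.gradient_step_contraction[OF strongly_convex_smooth_avg_fun[OF scs]])
    show "0 \<le> t" using t_ge b_pos by linarith
    show "t * (L + \<mu>) \<le> 1"
      using mult_right_mono[OF t_le, of "L + \<mu>"] L_pos mu_pos a_small by linarith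
  qed (rule L_pos)
  also have "\<dots> \<le> (1 - b * \<mu>) * norm (?m - xs)"
    using t_ge mu_pos by (intro mult_right_mono) auto
  finally have exact: "norm (?m - t *\<^sub>R ?gm ?m - xs) \<le> (1 - b * \<mu>) * norm (?m - xs)"
    by (simp add: stationary)
  have "norm (?gm ?m - row_mean (y k)) = norm (row_mean ((\<chi> i. g i ((\<chi> i. ?m) $ i)) - (\<chi> i. g i (x k $ i))))"
    by (simp add: tracking row_mean_diff)
  also have "\<dots> \<le> norm ((\<chi> i. g i ((\<chi> i. ?m) $ i)) - (\<chi> i. g i (x k $ i))) / ?s"
    by (rule norm_row_mean_le)
  also have "\<dots> \<le> L * norm (deviation (x k)) / ?s"
    using gradient_stack_lipschitz[of "\<chi> i. ?m" "x k"]
    by (simp add: deviation_def norm_minus_commute divide_right_mono)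
  finally have "t * norm (?gm ?m - row_mean (y k)) \<le> a * (L * norm (deviation (x k)) / ?s)"
    using t_le t_ge b_pos a_nonneg by (intro mult_mono) auto
  then have bias: "norm (t *\<^sub>R (?gm ?m - row_mean (y k))) \<le> L * (a / ?s) * norm (deviation (x k))"
    using t_ge b_pos by (simp add: mult_ac)
  have "norm (row_mean (\<chi> i. \<alpha> k i *\<^sub>R (deviation (y k) $ i)))
      \<le> norm (\<chi> i. \<alpha> k i *\<^sub>R (deviation (y k) $ i)) / ?s"
    by (rule norm_row_mean_le)
  also have "\<dots> \<le> a / ?s * norm (deviation (y k))"
    using norm_scaled_rows_le[of "deviation (y k)"] by (simp add: divide_right_mono)
  finally have heterogeneity: "norm (row_mean (\<chi> i. \<alpha> k i *\<^sub>R (deviation (y k) $ i)))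
      \<le> a / ?s * norm (deviation (y k))" .
  have "row_mean (x (Suc k)) - xs = (?m - t *\<^sub>R ?gm ?m - xs)
      + t *\<^sub>R (?gm ?m - row_mean (y k)) - row_mean (\<chi> i. \<alpha> k i *\<^sub>R (deviation (y k) $ i))"
    by (simp add: x_step row_mean_mult row_mean_diff split algebra_simps)
  then have "norm (row_mean (x (Suc k)) - xs) \<le> norm (?m - t *\<^sub>R ?gm ?m - xs)
      + norm (t *\<^sub>R (?gm ?m - row_mean (y k))) + norm (row_mean (\<chi> i. \<alpha> k i *\<^sub>R (deviation (y k) $ i)))"
    by (metis (no_types, lifting) norm_triangle_ineq4 norm_triangle_ineq add_right_mono order_trans)
  then show ?thesis using exact bias heterogeneity by linarith
qed

end

end

section \<open>Linear convergence\<close>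

theorem theorem2:
  fixes E :: "('n::finite \<times> 'n) set"
    and W :: "real ^ 'n ^ 'n"
    and f :: "'n \<Rightarrow> real ^ 'p::finite \<Rightarrow> real"
    and Lf \<mu>f :: "'n \<Rightarrow> real"
    and x y :: "nat \<Rightarrow> real ^ 'p ^ 'n"
    and \<alpha> \<theta> :: "nat \<Rightarrow> 'n \<Rightarrow> real"
    and \<gamma> n L \<mu> lam w \<delta>1 \<delta>2 \<alpha>bar \<alpha>max :: real
    and \<Upsilon> :: "complex mat"
  assumes graph: "undirected_connected E"
    and mixing: "mixing_matrix E W"
    and smooth: "\<And>i. smooth_with (Lf i) (f i)"
    and strongly_convex: "\<And>i. strongly_convex_with (\<mu>f i) (f i)"
    and \<mu>f_pos: "\<And>i. \<mu>f i > 0"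
    and \<gamma>_pos: "\<gamma> > 0"
    and run: "AdGT E W f \<gamma> x y \<alpha> \<theta>"
    and init_distinct: "\<And>i. x 1 $ i \<noteq> x 0 $ i"
    and init_step: "\<And>i. \<alpha> 0 i \<ge> 1 / (2 * \<gamma> * Lf i)"
    and n_eq: "n = real CARD('n)"
    and L_eq: "L = Max (range Lf)"
    and \<mu>_eq: "\<mu> = Min (range \<mu>f)"
    and lam_eq: "lam = mixing_rate W"
    and lam_pos: "lam > 0"
    and w_eq: "w = spectral_norm (W - Finite_Cartesian_Product.mat 1)"
    and \<delta>1: "0 < \<delta>1" "\<delta>1 < (1 - lam) / (L * w)"
    and \<delta>2: "\<delta>2 > (L / sqrt n * \<delta>1 + 1 / sqrt n) * (L / \<mu>\<^sup>2)"
    and \<alpha>bar_eq: "\<alpha>bar = min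
          ((1 - lam) * \<delta>1 / (lam * (L * \<delta>1 + 1 + sqrt n * L * \<delta>2)))
          (((1 - lam) - L * w * \<delta>1) / (L * (L * \<delta>1 + 1 + sqrt n * L * \<delta>2)))"
    and \<gamma>_large: "\<gamma> > max (L / \<mu>) (1 / (2 * \<mu> * \<alpha>bar))"
    and \<alpha>max_eq: "\<alpha>max = (SUP (i, k) \<in> UNIV \<times> {1..}. \<alpha> k i)"
    and \<Upsilon>_eq: "\<Upsilon> = Upsilon n lam w \<alpha>max L \<mu> \<gamma>"
  shows "spectral_radius \<Upsilon> < 1 \<and>
    (\<forall>\<zeta>. 0 < \<zeta> \<and> \<zeta> < 1 - spectral_radius \<Upsilon> \<longrightarrow>
      (\<exists>C\<ge>0. \<forall>k\<ge>1.
        norm (x k - (\<chi> i. unique_minimizer (avg_fun f)))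
          \<le> C * (spectral_radius \<Upsilon> + \<zeta>) ^ (k - 1)))"
proof -
  let ?g = "\<lambda>i. grad (f i)"
  let ?xs = "unique_minimizer (avg_fun f)"
  let ?dx = "\<lambda>k. norm (deviation (x k))"
  let ?dy = "\<lambda>k. norm (deviation (y k))"
  let ?dm = "\<lambda>k. norm (row_mean (x k) - ?xs)"

  \<comment> \<open>common constants for all agents and for the average function\<close>
  have Lf_le: "Lf i \<le> L" for i unfolding L_eq by simp
  have \<mu>f_ge: "\<mu> \<le> \<mu>f i" for i unfolding \<mu>_eq by simp
  have \<mu>_pos: "\<mu> > 0"
    using Min_in[of "range \<mu>f"] \<mu>f_pos unfolding \<mu>_eq by auto
  have scs_i: "strongly_convex_smooth (f i) (?g i) (Lf i) (\<mu>f i)" for i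
    using smooth[of i] strongly_convex[of i] \<mu>f_pos[of i]
    unfolding smooth_with_def strongly_convex_with_def by unfold_locales auto
  have curvature_le: "\<mu>f i \<le> Lf i" for i
    by (rule strongly_convex_smooth.lipschitz_ge_convexity[OF scs_i init_distinct])
  have "\<mu> \<le> L" using curvature_le \<mu>f_ge Lf_le by (meson order_trans)
  then have L_pos: "L > 0" using \<mu>_pos by linarith
  have scs: "strongly_convex_smooth (f i) (?g i) L \<mu>" for i
    by (rule strongly_convex_smooth_weaken[OF scs_i Lf_le \<mu>_pos \<mu>f_ge])
  note scs_avg = strongly_convex_smooth_avg_fun[of f ?g, OF scs]

  have "continuous_on UNIV (f i)" for i
    using smooth[of i] differentiable_imp_continuous_within
    unfolding smooth_with_def continuous_on_eq_continuous_within by blast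
  then have "continuous_on UNIV (avg_fun f)"
    unfolding avg_fun_def by (intro continuous_intros)
  from strongly_convex_stationary_point[OF scs_avg this]
  have stationary: "row_mean (\<chi> i. ?g i ?xs) = 0"
    using strongly_convex_smooth.minimizer_unique[OF scs_avg] by metis

  have alg: "y 0 $ i = ?g i (x 0 $ i)" "\<theta> 0 i = 0"
      "x (Suc k) $ i = (\<Sum>j\<in>nbhd E i. (W $ i $ j) *\<^sub>R (x k $ j - \<alpha> k j *\<^sub>R (y k $ j)))"
      "y (Suc k) $ i = (\<Sum>j\<in>nbhd E i. (W $ i $ j) *\<^sub>R (y k $ j))
          + ?g i (x (Suc k) $ i) - ?g i (x k $ i)"
      "\<alpha> (Suc k) i = (if k \<ge> 1 \<and> x (Suc k) $ i = x k $ i then \<alpha> k i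
         else min (1 / (2 * \<gamma> * local_lipschitz (f i) (x k $ i) (x (Suc k) $ i)))
                  (sqrt (1 + \<theta> k i) * \<alpha> k i))"
      "\<theta> (Suc k) i = \<alpha> (Suc k) i / \<alpha> k i" for k i
    using run unfolding AdGT_def by blast+
  interpret mix: mixing E W by unfold_locales (fact graph, fact mixing)
  have nbhd_sum: "(\<Sum>j\<in>nbhd E i. (W $ i $ j) *\<^sub>R (X $ j)) = (W ** X) $ i"
    for X :: "real^'p^'n" and i
    unfolding matrix_matrix_mult_row by (rule sum.mono_neutral_left) (auto simp: mix.weight_zero)
  interpret gradient_tracking E W f ?g L \<mu> x y \<alpha> ?xs
  proof (intro gradient_tracking.intro gradient_tracking_axioms.intro)
    fix i k
    show "mixing E W" by (rule mix.mixing_axioms)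
    show "strongly_convex_smooth (f i) (?g i) L \<mu>" by (rule scs)
    show "x (Suc k) = W ** (x k - (\<chi> i. \<alpha> k i *\<^sub>R (y k $ i)))"
      unfolding Finite_Cartesian_Product.vec_eq_iff nbhd_sum[symmetric] alg(3) by simp
    show "y (Suc k) = W ** y k + ((\<chi> i. ?g i (x (Suc k) $ i)) - (\<chi> i. ?g i (x k $ i)))"
      unfolding Finite_Cartesian_Product.vec_eq_iff
      by (simp only: alg(4) nbhd_sum vector_add_component vector_minus_component vec_lambda_beta
          add_diff_eq simp_thms)
    show "y 0 = (\<chi> i. ?g i (x 0 $ i))"
      by (simp add: Finite_Cartesian_Product.vec_eq_iff alg(1))
  qed (use L_pos lam_pos lam_eq stationary in auto)

  have local_bounds: "\<mu>f i \<le> local_lipschitz (f i) (x k $ i) (x (Suc k) $ i)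
      \<and> local_lipschitz (f i) (x k $ i) (x (Suc k) $ i) \<le> Lf i"
    if "x (Suc k) $ i \<noteq> x k $ i" for i k
    using that strongly_convex_smooth.gradient_expansive[OF scs_i[of i], of "x (Suc k) $ i" "x k $ i"]
      strongly_convex_smooth.gradient_lipschitz[OF scs_i[of i], of "x (Suc k) $ i" "x k $ i"]
    by (simp add: local_lipschitz_def pos_le_divide_eq pos_divide_le_eq)
  have step_i: "1 / (2 * \<gamma> * Lf i) \<le> \<alpha> k i" "\<alpha> (Suc k) i \<le> 1 / (2 * \<gamma> * \<mu>f i)" for i k
  proof -
    have "x (Suc k) $ i \<noteq> x k $ i" if "\<not> (k \<ge> 1 \<and> x (Suc k) $ i = x k $ i)" for k
      using that init_distinct[of i] by (cases k) auto
    then have "\<mu>f i \<le> local_lipschitz (f i) (x k $ i) (x (Suc k) $ i)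
        \<and> local_lipschitz (f i) (x k $ i) (x (Suc k) $ i) \<le> Lf i"
      if "\<not> (k \<ge> 1 \<and> x (Suc k) $ i = x k $ i)" for k
      using local_bounds that by blast
    \<comment> \<open>an agent that does not move keeps its stepsize; \<open>init_distinct\<close> excludes this for the first update\<close>
    note bounds = stepsize_bounds[where \<alpha> = "\<lambda>k. \<alpha> k i" and \<theta> = "\<lambda>k. \<theta> k i"
        and stalled = "\<lambda>k. k \<ge> 1 \<and> x (Suc k) $ i = x k $ i"
        and c = "\<lambda>k. local_lipschitz (f i) (x k $ i) (x (Suc k) $ i)",
        OF \<gamma>_pos \<mu>f_pos[of i] init_step[of i] alg(2) _ alg(5) alg(6) this, simplified]
    show "1 / (2 * \<gamma> * Lf i) \<le> \<alpha> k i" "\<alpha> (Suc k) i \<le> 1 / (2 * \<gamma> * \<mu>f i)"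
      using bounds by auto
  qed
  have step_ge: "1 / (2 * \<gamma> * L) \<le> \<alpha> k i" for k i
  proof -
    have "Lf i > 0" using curvature_le[of i] \<mu>f_pos[of i] by linarith
    then have "1 / (2 * \<gamma> * L) \<le> 1 / (2 * \<gamma> * Lf i)"
      using Lf_le[of i] \<gamma>_pos by (intro divide_left_mono mult_left_mono mult_pos_pos) auto
    then show ?thesis using step_i(1)[of i k] by linarith
  qed
  have step_le: "\<alpha> k i \<le> 1 / (2 * \<gamma> * \<mu>)" if "k \<ge> 1" for k i
  proof -
    obtain l where "k = Suc l" using \<open>k \<ge> 1\<close> by (cases k) auto
    moreover have "1 / (2 * \<gamma> * \<mu>f i) \<le> 1 / (2 * \<gamma> * \<mu>)"
      using \<mu>f_ge[of i] \<mu>_pos \<mu>f_pos[of i] \<gamma>_pos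
      by (intro divide_left_mono mult_left_mono mult_pos_pos) auto
    ultimately show ?thesis using step_i(2)[of l i] order_trans by blast
  qed
  have \<alpha>max_le: "\<alpha>max \<le> 1 / (2 * \<gamma> * \<mu>)"
    unfolding \<alpha>max_eq by (rule cSUP_least) (auto intro: step_le)
  have le_\<alpha>max: "\<alpha> k i \<le> \<alpha>max" if "k \<ge> 1" for k i
  proof -
    have "bdd_above ((\<lambda>(i, k). \<alpha> k i) ` (UNIV \<times> {1..}))"
      by (rule bdd_aboveI[of _ "1 / (2 * \<gamma> * \<mu>)"]) (auto intro: step_le)
    from cSUP_upper[OF _ this, of "(i, k)"] show ?thesis using that by (simp add: \<alpha>max_eq)
  qed
  have base_pos: "1 / (2 * \<gamma> * L) > 0" using \<gamma>_pos L_pos by simp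
  have \<alpha>max_pos: "\<alpha>max > 0"
    using le_\<alpha>max[of 1 undefined] step_ge[of 1 undefined] base_pos by linarith

  \<comment> \<open>\<open>\<alpha>max \<le> 1 / (2 * \<gamma> * \<mu>) < 1 / (2 * L) \<le> 1 / (L + \<mu>)\<close>, as the gradient step requires\<close>
  have \<gamma>\<mu>: "L < \<gamma> * \<mu>" using \<gamma>_large \<mu>_pos by (simp add: divide_less_eq)
  have small: "\<alpha>max * (L + \<mu>) \<le> 1"
  proof -
    have "\<alpha>max * (L + \<mu>) \<le> 1 / (2 * \<gamma> * \<mu>) * (2 * L)"
      using \<alpha>max_le \<alpha>max_pos \<open>\<mu> \<le> L\<close> L_pos \<mu>_pos \<gamma>_pos by (intro mult_mono) auto
    also have "\<dots> \<le> 1" using \<gamma>\<mu> L_pos by (simp add: divide_le_eq mult_ac)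
    finally show ?thesis .
  qed

  have n_pos: "n > 0" "sqrt n > 0" unfolding n_eq by auto
  have w_nonneg: "w \<ge> 0"
    unfolding w_eq spectral_norm_def by (rule onorm_pos_le[OF matrix_vector_mul_bounded_linear])
  \<comment> \<open>the interval for \<open>\<delta>1\<close> is nonempty only if \<open>lam < 1\<close> and \<open>w > 0\<close>; this also rules out a single agent\<close>
  have "0 < (1 - lam) / (L * w)" using \<delta>1 by linarith
  then have Lw_pos: "L * w > 0" and lam_less: "lam < 1"
    using L_pos w_nonneg by (auto simp: zero_less_divide_iff mult_less_0_iff)
  have Lw\<delta>1: "L * w * \<delta>1 < 1 - lam"
    using \<delta>1(2) Lw_pos by (simp add: pos_less_divide_eq mult_ac)
  have "(L / sqrt n * \<delta>1 + 1 / sqrt n) * (L / \<mu>\<^sup>2) > 0"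
    using n_pos L_pos \<mu>_pos \<delta>1(1) by (intro mult_pos_pos add_pos_pos divide_pos_pos) auto
  then have \<delta>2_pos: "\<delta>2 > 0" using \<delta>2 by linarith
  define S where "S = L * \<delta>1 + 1 + sqrt n * L * \<delta>2"
  have S_pos: "S > 0"
    unfolding S_def using n_pos L_pos \<delta>1(1) \<delta>2_pos by (intro add_pos_pos mult_pos_pos) auto
  have \<alpha>bar_pos: "\<alpha>bar > 0"
    unfolding \<alpha>bar_eq S_def[symmetric] using S_pos lam_pos lam_less L_pos \<delta>1(1) Lw\<delta>1 by simp
  have "1 / (2 * \<gamma> * \<mu>) < \<alpha>bar"
    using \<gamma>_large \<alpha>bar_pos \<mu>_pos \<gamma>_pos by (simp add: divide_less_eq mult_ac)
  then have "\<alpha>max < \<alpha>bar" using \<alpha>max_le by linarith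
  then have \<alpha>max_less: "\<alpha>max < (1 - lam) * \<delta>1 / (lam * S)"
      "\<alpha>max < ((1 - lam) - L * w * \<delta>1) / (L * S)"
    unfolding \<alpha>bar_eq S_def by auto

  define rows where "rows =
    [[lam + lam * \<alpha>max * L, lam * \<alpha>max, sqrt n * lam * \<alpha>max * L],
     [L * (w + L * \<alpha>max), lam + L * \<alpha>max, sqrt n * L\<^sup>2 * \<alpha>max],
     [L * (\<alpha>max / sqrt n), \<alpha>max / sqrt n, 1 - \<mu> / (2 * \<gamma> * L)]]"
  define N where "N i j = rows ! i ! j" for i j
  define d where "d i = [\<delta>1, 1, \<delta>2] ! i" for i
  \<comment> \<open>shifted by one: \<open>\<alpha>max\<close> bounds the stepsizes only from the first update on\<close>
  define v where "v k i = [?dx (Suc k), ?dy (Suc k), ?dm (Suc k)] ! i" for k i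
  have less_3: "P i" if "i < 3" "P 0" "P 1" "P 2" for P and i :: nat
    using that by (metis One_nat_def Suc_1 less_antisym not_less0 numeral_3_eq_3)
  have sum_3: "(\<Sum>j<3. h j) = h 0 + h 1 + h 2" for h :: "nat \<Rightarrow> real"
    by (simp add: numeral_3_eq_3 numeral_2_eq_2)
  have \<Upsilon>_N: "\<Upsilon> = complex_mat_of 3 N"
    unfolding \<Upsilon>_eq Upsilon_def complex_mat_of_def N_def rows_def
    by (rule eq_matI) (auto simp: mat_of_rows_list_def)
  have corner: "0 \<le> 1 - \<mu> / (2 * \<gamma> * L)"
  proof -
    have "\<mu> < \<gamma> * \<mu>" using \<gamma>\<mu> \<open>\<mu> \<le> L\<close> by linarith
    then have "1 < \<gamma>" using \<mu>_pos by simp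
    then have "1 * L \<le> (2 * \<gamma>) * L" using L_pos by (intro mult_right_mono) auto
    then have "\<mu> \<le> 2 * \<gamma> * L" using \<open>\<mu> \<le> L\<close> by linarith
    then show ?thesis using \<gamma>_pos L_pos by (simp add: divide_le_eq)
  qed
  have N_nonneg: "N i j \<ge> 0" if "i < 3" "j < 3" for i j
    using that(1)
  proof (rule less_3)
    show "N 0 j \<ge> 0" "N 1 j \<ge> 0" "N 2 j \<ge> 0"
      using that(2) lam_pos L_pos w_nonneg \<alpha>max_pos n_pos corner
      by - (rule less_3; simp add: N_def rows_def)+
  qed
  have d_pos: "d i > 0" if "i < 3" for i
    using that by (rule less_3) (simp_all add: d_def \<delta>1 \<delta>2_pos)
  have sub: "(\<Sum>j<3. N i j * d j) < d i" if "i < 3" for i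
    using that
  proof (rule less_3)
    have "\<alpha>max * (lam * S) < (1 - lam) * \<delta>1"
      using \<alpha>max_less(1) lam_pos S_pos by (simp add: pos_less_divide_eq)
    then show "(\<Sum>j<3. N 0 j * d j) < d 0"
      by (simp add: sum_3 N_def rows_def d_def S_def algebra_simps)
    have "\<alpha>max * (L * S) < 1 - lam - L * w * \<delta>1"
      using \<alpha>max_less(2) L_pos S_pos by (simp add: pos_less_divide_eq)
    then show "(\<Sum>j<3. N 1 j * d j) < d 1"
      by (simp add: sum_3 N_def rows_def d_def S_def algebra_simps power2_eq_square)
    \<comment> \<open>the third row needs \<open>\<alpha>max \<le> 1 / (2 * \<gamma> * \<mu>)\<close> itself: then \<open>\<gamma>\<close> cancels against the factor
      \<open>\<mu> / (2 * \<gamma> * L)\<close>, and the lower bound on \<open>\<delta>2\<close> remains\<close>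
    have "\<alpha>max * (L / sqrt n * \<delta>1 + 1 / sqrt n)
        \<le> 1 / (2 * \<gamma> * \<mu>) * (L / sqrt n * \<delta>1 + 1 / sqrt n)"
      using \<alpha>max_le n_pos L_pos \<delta>1(1) by (intro mult_right_mono) auto
    also have "\<dots> < 1 / (2 * \<gamma> * \<mu>) * (\<delta>2 * \<mu>\<^sup>2 / L)"
    proof (rule mult_strict_left_mono)
      show "L / sqrt n * \<delta>1 + 1 / sqrt n < \<delta>2 * \<mu>\<^sup>2 / L"
        using \<delta>2 L_pos \<mu>_pos by (simp add: pos_less_divide_eq pos_divide_less_eq)
    qed (use \<gamma>_pos \<mu>_pos in simp)
    also have "\<dots> = \<mu> / (2 * \<gamma> * L) * \<delta>2"
      using \<gamma>_pos \<mu>_pos L_pos by (simp add: power2_eq_square)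
    finally show "(\<Sum>j<3. N 2 j * d j) < d 2"
      by (simp add: sum_3 N_def rows_def d_def algebra_simps)
  qed
  have radius: "spectral_radius \<Upsilon> < 1"
    unfolding \<Upsilon>_N by (rule spectral_radius_less_1_if_subinvariant[OF _ N_nonneg d_pos sub]) auto

  have rec: "v (Suc k) i \<le> (\<Sum>j<3. N i j * v k j)" if "i < 3" for k i
    using that
  proof (rule less_3)
    let ?k = "Suc k"
    note step = le_\<alpha>max[of ?k, simplified] step_ge[of ?k] base_pos small
    have y_le: "norm (y ?k) \<le> L * ?dx ?k + ?dy ?k + sqrt n * L * ?dm ?k"
      using norm_tracker_le[of ?k] by (simp add: n_eq)
    have "lam * (\<alpha>max * norm (y ?k)) \<le> lam * (\<alpha>max * (L * ?dx ?k + ?dy ?k + sqrt n * L * ?dm ?k))"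
      using y_le lam_pos \<alpha>max_pos by (intro mult_left_mono) auto
    then show "v (Suc k) 0 \<le> (\<Sum>j<3. N 0 j * v k j)"
      using consensus_error_step[OF step] unfolding lam_eq[symmetric]
      by (simp add: sum_3 N_def rows_def v_def algebra_simps)
    have "L * (\<alpha>max * norm (y ?k)) \<le> L * (\<alpha>max * (L * ?dx ?k + ?dy ?k + sqrt n * L * ?dm ?k))"
      using y_le L_pos \<alpha>max_pos by (intro mult_left_mono) auto
    then show "v (Suc k) 1 \<le> (\<Sum>j<3. N 1 j * v k j)"
      using tracking_error_step[OF step] unfolding lam_eq[symmetric] w_eq[symmetric]
      by (simp add: sum_3 N_def rows_def v_def algebra_simps power2_eq_square)
    show "v (Suc k) 2 \<le> (\<Sum>j<3. N 2 j * v k j)"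
      using optimality_error_step[OF step] unfolding n_eq[symmetric]
      by (simp add: sum_3 N_def rows_def v_def)
  qed

  have "\<exists>C\<ge>0. \<forall>k\<ge>1. norm (x k - (\<chi> i. ?xs)) \<le> C * (spectral_radius \<Upsilon> + \<zeta>) ^ (k - 1)"
    if "\<zeta> > 0" for \<zeta>
  proof -
    let ?r = "spectral_radius \<Upsilon> + \<zeta>"
    have "spectral_radius (complex_mat_of 3 N) < ?r" using that \<Upsilon>_N by simp
    from recursive_inequality_geometric_bound[where m = 3 and N = N and v = v, OF _ N_nonneg rec this]
    obtain C where C: "\<And>k i. i < 3 \<Longrightarrow> v k i \<le> C * ?r ^ k" by auto
    have bound: "norm (x k - (\<chi> i. ?xs)) \<le> ((1 + sqrt n) * C) * ?r ^ (k - 1)" if "k \<ge> 1" for k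
    proof -
      obtain l where k: "k = Suc l" using \<open>k \<ge> 1\<close> by (cases k) auto
      have "norm (x k - (\<chi> i. ?xs)) \<le> v l 0 + sqrt n * v l 2"
        using norm_minus_const_le[of k ?xs] by (simp add: v_def k n_eq)
      also have "\<dots> \<le> C * ?r ^ l + sqrt n * (C * ?r ^ l)"
        using C n_pos by (intro add_mono mult_left_mono) auto
      finally show ?thesis by (simp add: k algebra_simps)
    qed
    have "0 \<le> v 0 0" by (simp add: v_def)
    then have "0 \<le> C" using C[of 0 0] by simp
    then have "0 \<le> (1 + sqrt n) * C" using n_pos by simp
    then show ?thesis using bound by blast
  qed
  then show ?thesis using radius by blast
qed

end
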